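(* Let $\mathfrak f=(f_0,f_1)\in S$. There exist a time $T\ge 0$ and a bounded measurable control $u:[0,T]\to\mathbb R$ (bounded by some constant, not necessarily by $1$) such that the solution of $\frac{\partial \mathfrak f}{\partial t}=A\mathfrak f+Bu$ with initial state $\mathfrak f(0)=\mathfrak f$ satisfies $\mathfrak f(T)\in\mathcal C=\mathbb R^2$, i.e. $\mathfrak f(T)$ is a pair of constants (damping of oscillations), if and only if $\frac{\partial f_0}{\partial x}\in L_\infty(\mathcal T)$ and $f_1\in L_\infty(\mathcal T)$.
   Context: $\mathcal T=\mathbb R/2\pi\mathbb Z$ is the one-dimensional torus and $S$ is the space of pairs $\mathfrak f=(f_0,f_1)$ of even real distributions on $\mathcal T$; $\mathcal C=\{(c_0,c_1)\in\mathbb R^2\}\subset S$ is the subspace of pairs of constant functions. The controlled closed string is $\frac{\partial^2 f}{\partial t^2}=\frac{\partial^2 f}{\partial x^2}+u(t)\delta$, with $\delta$ the Dirac delta at $0\in\mathcal T$, $f_0=f$, $f_1=\frac{\partial f}{\partial t}$. It is written as the first-order system $\frac{\partial\mathfrak f}{\partial t}=A\mathfrak f+Bu$ with $A=\begin{pmatrix}0&1\\ \Delta&0\end{pmatrix}$, $\Delta=\frac{\partial^2}{\partial x^2}$, $B=\begin{pmatrix}0\\ \delta\end{pmatrix}$; solutions are understood in the sense of distributions, i.e. $\mathfrak f(t)=e^{At}\mathfrak f(0)+\int_0^t e^{A(t-s)}Bu(s)\,ds$. *)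

theory Defs
  imports "HOL-Analysis.Analysis"
begin

text \<open>
  Functions on the torus are rendered as \<open>2\<pi>\<close>-periodic functions on the real line.
\<close>

definition smooth_periodic :: "(real \<Rightarrow> real) \<Rightarrow> bool" where
  "smooth_periodic \<phi> \<longleftrightarrow>
     (\<forall>x. \<phi> (x + 2 * pi) = \<phi> x) \<and> (\<forall>n x. (deriv ^^ n) \<phi> differentiable (at x))"

lemma higher_deriv_add:
  fixes f g :: "real \<Rightarrow> real"
  assumes "\<And>n x. (deriv ^^ n) f differentiable (at x)"
    and "\<And>n x. (deriv ^^ n) g differentiable (at x)"
  shows "(deriv ^^ n) (\<lambda>x. f x + g x) = (\<lambda>x. (deriv ^^ n) f x + (deriv ^^ n) g x)"
proof (induction n)
  case (Suc n)
  have "deriv (\<lambda>x. (deriv ^^ n) f x + (deriv ^^ n) g x) x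
      = deriv ((deriv ^^ n) f) x + deriv ((deriv ^^ n) g) x" for x
    using assms by (intro DERIV_imp_deriv DERIV_add)
      (auto simp: DERIV_deriv_iff_real_differentiable)
  with Suc show ?case by auto
qed simp

lemma higher_deriv_cmult:
  fixes f :: "real \<Rightarrow> real"
  assumes "\<And>n x. (deriv ^^ n) f differentiable (at x)"
  shows "(deriv ^^ n) (\<lambda>x. c * f x) = (\<lambda>x. c * (deriv ^^ n) f x)"
proof (induction n)
  case (Suc n)
  have "deriv (\<lambda>x. c * (deriv ^^ n) f x) x = c * deriv ((deriv ^^ n) f) x" for x
    using assms by (intro DERIV_imp_deriv DERIV_cmult)
      (auto simp: DERIV_deriv_iff_real_differentiable)
  with Suc show ?case by auto
qed simp

lemma higher_deriv_reflect:
  fixes f :: "real \<Rightarrow> real"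
  assumes "\<And>n x. (deriv ^^ n) f differentiable (at x)"
  shows "(deriv ^^ n) (\<lambda>x. f (- x)) = (\<lambda>x. (- 1) ^ n * (deriv ^^ n) f (- x))"
proof (induction n)
  case (Suc n)
  have "((\<lambda>x. (- 1) ^ n * (deriv ^^ n) f (- x)) has_real_derivative
      (- 1) ^ n * (deriv ((deriv ^^ n) f) (- x) * - 1)) (at x)" for x
    by (intro DERIV_cmult DERIV_chain2[where g = uminus])
      (use assms in \<open>auto simp: DERIV_deriv_iff_real_differentiable intro!: derivative_eq_intros\<close>)
  then have "deriv (\<lambda>x. (- 1) ^ n * (deriv ^^ n) f (- x)) x
      = (- 1) ^ Suc n * deriv ((deriv ^^ n) f) (- x)" for x
    using DERIV_imp_deriv by fastforce
  with Suc show ?case by auto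
qed simp

lemma higher_deriv_const: "(deriv ^^ n) (\<lambda>_. c :: real) = (\<lambda>_. if n = 0 then c else 0)"
  by (induction n) auto

lemma smooth_periodic_add:
  "smooth_periodic f \<Longrightarrow> smooth_periodic g \<Longrightarrow> smooth_periodic (\<lambda>x. f x + g x)"
  by (auto simp: smooth_periodic_def higher_deriv_add)

lemma smooth_periodic_cmult: "smooth_periodic f \<Longrightarrow> smooth_periodic (\<lambda>x. c * f x)"
  by (auto simp: smooth_periodic_def higher_deriv_cmult)

lemma smooth_periodic_const: "smooth_periodic (\<lambda>_. c)"
  by (auto simp: smooth_periodic_def higher_deriv_const)

lemma smooth_periodic_reflect:
  assumes "smooth_periodic f"
  shows "smooth_periodic (\<lambda>x. f (- x))"
proof -
  have d: "(deriv ^^ n) f differentiable (at x)" for n x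
    using assms by (simp add: smooth_periodic_def)
  have "f (- (x + 2 * pi)) = f (- x)" for x
    using assms[unfolded smooth_periodic_def, THEN conjunct1, rule_format, of "- x - 2 * pi"]
    by (simp add: algebra_simps)
  moreover have "(\<lambda>x. (- 1) ^ n * (deriv ^^ n) f (- x)) differentiable (at x)" for n x
    by (intro differentiable_mult differentiable_const
        differentiable_compose[where f = "(deriv ^^ n) f" and g = uminus])
      (auto intro: d)
  ultimately show ?thesis
    by (simp add: smooth_periodic_def higher_deriv_reflect d)
qed

lemma smooth_periodic_deriv:
  assumes "smooth_periodic f"
  shows "smooth_periodic (deriv f)"
proof -
  have per: "f (x + 2 * pi) = f x" and d: "(deriv ^^ n) f differentiable (at x)" for n x
    using assms by (simp_all add: smooth_periodic_def)
  have D: "(f has_real_derivative deriv f x) (at x)" for x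
    using d[of 0] by (simp add: DERIV_deriv_iff_real_differentiable)
  have "((\<lambda>x. f (x + 2 * pi)) has_real_derivative deriv f (x + 2 * pi)) (at x)" for x
    by (rule DERIV_shift[THEN iffD1]) (rule D)
  then have "deriv f (x + 2 * pi) = deriv f x" for x
    using D per DERIV_unique by fastforce
  moreover have "(deriv ^^ n) (deriv f) differentiable (at x)" for n x
    using d[of "Suc n"] by (simp add: funpow_swap1)
  ultimately show ?thesis
    by (simp add: smooth_periodic_def)
qed

typedef torus_test = "{\<phi>. smooth_periodic \<phi>}"
  morphisms test_fun Abs_torus_test
  using smooth_periodic_const by blast

setup_lifting type_definition_torus_test

instantiation torus_test :: real_vector
begin

lift_definition zero_torus_test :: torus_test is "\<lambda>_. 0"
  by (rule smooth_periodic_const)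

lift_definition plus_torus_test :: "torus_test \<Rightarrow> torus_test \<Rightarrow> torus_test"
  is "\<lambda>\<phi> \<psi> x. \<phi> x + \<psi> x"
  by (rule smooth_periodic_add)

lift_definition uminus_torus_test :: "torus_test \<Rightarrow> torus_test" is "\<lambda>\<phi> x. - \<phi> x"
  using smooth_periodic_cmult[of _ "- 1"] by simp

lift_definition minus_torus_test :: "torus_test \<Rightarrow> torus_test \<Rightarrow> torus_test"
  is "\<lambda>\<phi> \<psi> x. \<phi> x - \<psi> x"
  using smooth_periodic_add[OF _ smooth_periodic_cmult[of _ "- 1"]] by simp

lift_definition scaleR_torus_test :: "real \<Rightarrow> torus_test \<Rightarrow> torus_test"
  is "\<lambda>c \<phi> x. c * \<phi> x"
  by (rule smooth_periodic_cmult)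

instance
  by standard (transfer; simp add: algebra_simps)+

end

lift_definition test_deriv :: "torus_test \<Rightarrow> torus_test" is deriv
  by (rule smooth_periodic_deriv)

lift_definition test_reflect :: "torus_test \<Rightarrow> torus_test" is "\<lambda>\<phi> x. \<phi> (- x)"
  by (rule smooth_periodic_reflect)

lemma linear_test_deriv: "linear test_deriv"
proof (rule linearI)
  have D: "(\<phi> has_real_derivative deriv \<phi> x) (at x)" if "smooth_periodic \<phi>" for \<phi> x
    using that[unfolded smooth_periodic_def, THEN conjunct2, rule_format, of 0]
    by (simp add: DERIV_deriv_iff_real_differentiable)
  show "test_deriv (\<phi> + \<psi>) = test_deriv \<phi> + test_deriv \<psi>" for \<phi> \<psi>
    by transfer (intro ext DERIV_imp_deriv DERIV_add D)
  show "test_deriv (c *\<^sub>R \<phi>) = c *\<^sub>R test_deriv \<phi>" for c \<phi>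
    by transfer (intro ext DERIV_imp_deriv DERIV_cmult D)
qed

text \<open>
  Convergence in \<open>C\<^sup>\<infinity>\<close>. This space is metrizable, so that sequential continuity of a
  linear functional is continuity.
\<close>

definition test_tendsto :: "(nat \<Rightarrow> torus_test) \<Rightarrow> torus_test \<Rightarrow> bool" where
  "test_tendsto X \<phi> \<longleftrightarrow>
     (\<forall>k. uniform_limit UNIV (\<lambda>n. (deriv ^^ k) (test_fun (X n))) ((deriv ^^ k) (test_fun \<phi>))
            sequentially)"

lemma test_tendsto_deriv:
  "test_tendsto X \<phi> \<Longrightarrow> test_tendsto (\<lambda>n. test_deriv (X n)) (test_deriv \<phi>)"
  unfolding test_tendsto_def test_deriv.rep_eq
  by (auto simp: funpow_swap1 dest: spec[of _ "Suc _"])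

typedef torus_distribution =
  "{F :: torus_test \<Rightarrow> real. linear F \<and>
      (\<forall>X \<phi>. test_tendsto X \<phi> \<longrightarrow> (\<lambda>n. F (X n)) \<longlonglongrightarrow> F \<phi>)}"
  morphisms pairing Abs_torus_distribution
  by (rule exI[of _ "\<lambda>_. 0"]) (auto simp: linear_iff)

setup_lifting type_definition_torus_distribution

instantiation torus_distribution :: real_vector
begin

lift_definition zero_torus_distribution :: torus_distribution is "\<lambda>_. 0"
  by (auto simp: linear_iff)

lift_definition plus_torus_distribution ::
    "torus_distribution \<Rightarrow> torus_distribution \<Rightarrow> torus_distribution"
  is "\<lambda>F G \<phi>. F \<phi> + G \<phi>"
  by (auto intro: linear_compose_add tendsto_add)

lift_definition uminus_torus_distribution :: "torus_distribution \<Rightarrow> torus_distribution"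
  is "\<lambda>F \<phi>. - F \<phi>"
  by (auto intro: linear_compose_neg tendsto_minus)

lift_definition minus_torus_distribution ::
    "torus_distribution \<Rightarrow> torus_distribution \<Rightarrow> torus_distribution"
  is "\<lambda>F G \<phi>. F \<phi> - G \<phi>"
  by (auto intro: linear_compose_sub tendsto_diff)

lift_definition scaleR_torus_distribution ::
    "real \<Rightarrow> torus_distribution \<Rightarrow> torus_distribution"
  is "\<lambda>c F \<phi>. c * F \<phi>"
  by (auto simp: linear_iff algebra_simps intro: tendsto_mult_left)

instance
  by standard (transfer; simp add: algebra_simps)+

end

lift_definition dist_deriv :: "torus_distribution \<Rightarrow> torus_distribution"
  is "\<lambda>F \<phi>. - F (test_deriv \<phi>)"
  using linear_test_deriv test_tendsto_deriv
  by (auto simp: linear_iff intro!: tendsto_minus)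

lift_definition dirac :: torus_distribution is "\<lambda>\<phi>. test_fun \<phi> 0"
proof
  show "linear (\<lambda>\<phi>. test_fun \<phi> 0)"
    by (simp add: linear_iff plus_torus_test.rep_eq scaleR_torus_test.rep_eq)
  show "\<forall>X \<phi>. test_tendsto X \<phi> \<longrightarrow> (\<lambda>n. test_fun (X n) 0) \<longlonglongrightarrow> test_fun \<phi> 0"
    by (auto simp: test_tendsto_def dest!: spec[of _ "0 :: nat"] intro: tendsto_uniform_limitI)
qed

definition even_distribution :: "torus_distribution \<Rightarrow> bool" where
  "even_distribution F \<longleftrightarrow> (\<forall>\<phi>. pairing F (test_reflect \<phi>) = pairing F \<phi>)"

definition represents :: "(real \<Rightarrow> real) \<Rightarrow> torus_distribution \<Rightarrow> bool" where
  "represents g F \<longleftrightarrow>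
     (\<forall>\<phi>. has_bochner_integral (lebesgue_on {- pi..pi}) (\<lambda>x. g x * test_fun \<phi> x) (pairing F \<phi>))"

definition L_infinity :: "torus_distribution set" where
  "L_infinity = {F. \<exists>g \<in> borel_measurable (lebesgue_on {- pi..pi}).
     (\<exists>M. AE x in lebesgue_on {- pi..pi}. \<bar>g x\<bar> \<le> M) \<and> represents g F}"

type_synonym string_state = "torus_distribution \<times> torus_distribution"

definition state_space :: "string_state set" where
  "state_space = {(f0, f1). even_distribution f0 \<and> even_distribution f1}"

definition constant_states :: "string_state set" where
  "constant_states =
     {(f0, f1). \<exists>c0 c1. represents (\<lambda>_. c0) f0 \<and> represents (\<lambda>_. c1) f1}"

definition op_A :: "string_state \<Rightarrow> string_state" where
  "op_A f = (snd f, dist_deriv (dist_deriv (fst f)))"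

definition vec_B :: string_state where
  "vec_B = (0, dirac)"

definition has_weak_derivative ::
    "(real \<Rightarrow> string_state) \<Rightarrow> string_state \<Rightarrow> real \<Rightarrow> bool" where
  "has_weak_derivative g g' t \<longleftrightarrow>
     (\<forall>\<phi>. ((\<lambda>s. pairing (fst (g s)) \<phi>) has_real_derivative pairing (fst g') \<phi>) (at t) \<and>
          ((\<lambda>s. pairing (snd (g s)) \<phi>) has_real_derivative pairing (snd g') \<phi>) (at t))"

definition has_weak_integral ::
    "(real \<Rightarrow> string_state) \<Rightarrow> string_state \<Rightarrow> real set \<Rightarrow> bool" where
  "has_weak_integral g I X \<longleftrightarrow>
     (\<forall>\<phi>. has_bochner_integral (lebesgue_on X) (\<lambda>s. pairing (fst (g s)) \<phi>) (pairing (fst I) \<phi>) \<and>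
          has_bochner_integral (lebesgue_on X) (\<lambda>s. pairing (snd (g s)) \<phi>) (pairing (snd I) \<phi>))"

text \<open>
  The operator \<open>A\<close> is unbounded, and on distributions the exponential series does not converge.
  For \<open>f\<close> in the state space, \<open>t \<mapsto> e\<^bsup>At\<^esup> f\<close> is the unique curve \<open>g\<close> in the
  state space, defined for all real times, with \<open>g(0) = f\<close> and \<open>g' = A g\<close>.
\<close>

definition exp_A :: "real \<Rightarrow> string_state \<Rightarrow> string_state" where
  "exp_A t f =
     (THE g. (\<forall>s. g s \<in> state_space) \<and> g 0 = f \<and>
             (\<forall>s. has_weak_derivative g (op_A (g s)) s)) t"

definition string_solution ::
    "real \<Rightarrow> (real \<Rightarrow> real) \<Rightarrow> string_state \<Rightarrow> (real \<Rightarrow> string_state) \<Rightarrow> bool" where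
  "string_solution T u f g \<longleftrightarrow>
     (\<forall>t\<in>{0..T}. \<exists>I. has_weak_integral (\<lambda>s. u s *\<^sub>R exp_A (t - s) vec_B) I {0..t} \<and>
                     g t = exp_A t f + I)"

end

theory Submission
  imports Defs "HOL-Library.Periodic_Fun"
begin

text \<open>
  Everything is transposed to test functions. With translations \<open>\<tau>\<^sub>t\<close>, the derivative \<open>D\<close>, the
  mean \<open>m\<close> and the periodic primitive \<open>P\<close> of \<open>\<phi> - m(\<phi>)\<close>, put
  \<open>C\<^sub>t = (\<tau>\<^sub>t + \<tau>\<^sub>-\<^sub>t) / 2\<close> and \<open>S\<^sub>t = t m + (\<tau>\<^sub>t - \<tau>\<^sub>-\<^sub>t) P / 2\<close>, which play the roles of
  \<open>cosh tD\<close> and \<open>sinh tD / D\<close>. D'Alembert's formula says that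
  \<open>e\<^bsup>At\<^esup> (f\<^sub>0, f\<^sub>1) = (f\<^sub>0 \<circ> C\<^sub>t + f\<^sub>1 \<circ> S\<^sub>t, f\<^sub>0 \<circ> S\<^sub>t D\<^sup>2 + f\<^sub>1 \<circ> C\<^sub>t)\<close>.
  That this curve solves the equation rests on the convergence in \<open>C\<^sup>\<infinity>\<close> of the difference quotients of
  translations (\<open>pairing_translate_has_deriv\<close>). It is the only solution (\<open>wave_unique\<close>), because against
  \<open>cos nx\<close> and \<open>sin nx\<close> the equation becomes a harmonic oscillator, whose energy is conserved, and
  trigonometric polynomials are dense in \<open>C\<^sup>\<infinity>\<close> (\<open>trig_smooth_approximation\<close>).

  Suppose that \<open>u\<close> damps the oscillations at time \<open>T\<close>. The identities
  \<open>C\<^sub>T C\<^sub>T - S\<^sub>T S\<^sub>T D\<^sup>2 = 1\<close> and \<open>C\<^sub>r C\<^sub>T - S\<^sub>r S\<^sub>T D\<^sup>2 = C\<^bsub>r-T\<^esub>\<close> allow one to run the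
  equation backwards from the constant state:
  \<open>f\<^sub>1(\<psi>) = c\<^sub>1 \<integral>\<psi> - \<integral>\<^sub>0\<^sup>T u(s) (\<psi>(s) + \<psi>(-s)) / 2 ds\<close> and
  \<open>f\<^sub>0'(\<psi>) = \<integral>\<^sub>0\<^sup>T u(s) (\<psi>(-s) - \<psi>(s)) / 2 ds\<close>.
  Winding \<open>[0,T]\<close> around the circle turns each such integral into one against a bounded density, since
  only finitely many translates of a bounded function are added (\<open>bounded_density_fold\<close>).

  Conversely, these formulas with \<open>c\<^sub>1 = 0\<close> can be solved for \<open>u\<close>: if \<open>a\<close> and \<open>b\<close> are densities of
  \<open>f\<^sub>1\<close> (even) and of \<open>f\<^sub>0'\<close> (odd), then \<open>u = - (a + b)\<close>, used during one period, does the job.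
  At a time that is a multiple of the period the group acts trivially up to constants, and what the
  control adds cancels \<open>f\<^sub>1\<close> and the non-constant part of \<open>f\<^sub>0\<close> (\<open>damped_if_densities\<close>).
\<close>

section \<open>Test functions on the torus\<close>

lemma test_fun_eqI: "(\<And>x. test_fun \<phi> x = test_fun \<psi> x) \<Longrightarrow> \<phi> = \<psi>"
  using test_fun_inject by blast

lemma test_fun_add: "test_fun (\<phi> + \<psi>) x = test_fun \<phi> x + test_fun \<psi> x"
  by (simp add: plus_torus_test.rep_eq)

lemma test_fun_diff: "test_fun (\<phi> - \<psi>) x = test_fun \<phi> x - test_fun \<psi> x"
  by (simp add: minus_torus_test.rep_eq)

lemma test_fun_uminus: "test_fun (- \<phi>) x = - test_fun \<phi> x"
  by (simp add: uminus_torus_test.rep_eq)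

lemma test_fun_scaleR: "test_fun (c *\<^sub>R \<phi>) x = c * test_fun \<phi> x"
  by (simp add: scaleR_torus_test.rep_eq)

lemma test_fun_zero: "test_fun 0 x = 0"
  by (simp add: zero_torus_test.rep_eq)

lemmas test_fun_simps =
  test_fun_add test_fun_diff test_fun_uminus test_fun_scaleR test_fun_zero

lemma test_fun_smooth: "smooth_periodic (test_fun \<phi>)"
  using test_fun by auto

lemma test_fun_periodic: "test_fun \<phi> (x + 2 * pi) = test_fun \<phi> x"
  using test_fun_smooth by (simp add: smooth_periodic_def)

lemma test_fun_has_deriv: "(test_fun \<phi> has_real_derivative test_fun (test_deriv \<phi>) x) (at x)"
  using test_fun_smooth[of \<phi>, unfolded smooth_periodic_def, THEN conjunct2, rule_format, of 0 x]
  by (simp add: DERIV_deriv_iff_real_differentiable test_deriv.rep_eq)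

lemma continuous_on_test_fun: "continuous_on A (test_fun \<phi>)"
  by (meson DERIV_isCont continuous_at_imp_continuous_on test_fun_has_deriv)

lemma continuous_on_test_fun' [continuous_intros]:
  "continuous_on A f \<Longrightarrow> continuous_on A (\<lambda>x. test_fun \<phi> (f x))"
  using continuous_on_compose2[OF continuous_on_test_fun] by blast

lemma test_deriv_funpow_rep_eq: "(deriv ^^ k) (test_fun \<phi>) = test_fun ((test_deriv ^^ k) \<phi>)"
  by (induction k) (simp_all add: test_deriv.rep_eq)

lemma test_tendsto_iff:
  "test_tendsto X \<phi> \<longleftrightarrow> (\<forall>k. uniform_limit UNIV (\<lambda>n. test_fun ((test_deriv ^^ k) (X n)))
     (test_fun ((test_deriv ^^ k) \<phi>)) sequentially)"
  by (simp add: test_tendsto_def test_deriv_funpow_rep_eq)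

lemma test_deriv_eqI:
  assumes "\<And>x. (test_fun \<phi> has_real_derivative test_fun \<psi> x) (at x)"
  shows "test_deriv \<phi> = \<psi>"
  by (rule test_fun_eqI) (use DERIV_unique[OF test_fun_has_deriv assms] in auto)

text \<open>Smoothness is inherited by primitives; this is how \<open>test_primitive\<close> stays among the test functions.\<close>

lemma smooth_periodicI:
  assumes "\<And>x. f (x + 2 * pi) = f x"
    and "\<And>x. (f has_real_derivative g x) (at x)" and "smooth_periodic g"
  shows "smooth_periodic f"
proof -
  have eq: "deriv f = g"
    using assms(2) DERIV_imp_deriv by blast
  have "(deriv ^^ n) f differentiable (at x)" for n x
  proof (cases n)
    case 0
    then show ?thesis
      using assms(2) real_differentiable_def by auto
  next
    case (Suc m)
    then have "(deriv ^^ n) f = (deriv ^^ m) g"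
      using eq by (simp add: funpow_swap1)
    then show ?thesis
      using assms(3) by (simp add: smooth_periodic_def)
  qed
  then show ?thesis
    using assms(1) by (simp add: smooth_periodic_def)
qed

lemma test_fun_periodic_int: "test_fun \<phi> (x + of_int n * (2 * pi)) = test_fun \<phi> x"
proof -
  interpret periodic_fun_simple "test_fun \<phi>" "2 * pi"
    by unfold_locales (rule test_fun_periodic)
  show ?thesis
    by (rule plus_of_int)
qed

lemma torus_representative:
  obtains n :: int and y :: real where "x = y + of_int n * (2 * pi)" "0 \<le> y" "y < 2 * pi"
proof
  define n where "n = \<lfloor>x / (2 * pi)\<rfloor>"
  show "x = (x - of_int n * (2 * pi)) + of_int n * (2 * pi)" by simp
  have "of_int n \<le> x / (2 * pi)" "x / (2 * pi) < of_int n + 1"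
    unfolding n_def by linarith+
  then show "0 \<le> x - of_int n * (2 * pi)" "x - of_int n * (2 * pi) < 2 * pi"
    by (simp_all add: field_simps)
qed

lemma test_fun_bounded: obtains M where "M \<ge> 0" "\<And>x. \<bar>test_fun \<phi> x\<bar> \<le> M"
proof -
  have "bounded (test_fun \<phi> ` {0..2*pi})"
    by (intro compact_imp_bounded compact_continuous_image continuous_on_test_fun) auto
  then obtain M where M: "\<And>x. x \<in> {0..2*pi} \<Longrightarrow> \<bar>test_fun \<phi> x\<bar> \<le> M"
    unfolding bounded_iff by (metis image_eqI real_norm_def)
  have "\<bar>test_fun \<phi> x\<bar> \<le> M" for x
    using M by (rule_tac x = x in torus_representative) (auto simp: test_fun_periodic_int)
  moreover from this[of 0] have "M \<ge> 0" by linarith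
  ultimately show ?thesis using that by blast
qed

text \<open>The mean value theorem, in the form in which it yields all the estimates below.\<close>

lemma test_fun_lipschitz:
  assumes "\<And>x. \<bar>test_fun (test_deriv \<phi>) x\<bar> \<le> M"
  shows "\<bar>test_fun \<phi> x - test_fun \<phi> y\<bar> \<le> M * \<bar>x - y\<bar>"
proof -
  have "norm (test_fun \<phi> x - test_fun \<phi> y) \<le> M * norm (x - y)"
    by (rule field_differentiable_bound[of UNIV _ "test_fun (test_deriv \<phi>)"])
      (use assms test_fun_has_deriv in auto)
  then show ?thesis by simp
qed

lemma test_fun_eq_if_deriv_eq:
  assumes "test_deriv \<phi> = test_deriv \<psi>" and "test_fun \<phi> 0 = test_fun \<psi> 0"
  shows "\<phi> = \<psi>"
proof (rule test_fun_eqI)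
  fix x
  have 0: "test_deriv (\<phi> - \<psi>) = 0"
    using assms(1) linear_diff[OF linear_test_deriv] by simp
  show "test_fun \<phi> x = test_fun \<psi> x"
    using test_fun_lipschitz[of "\<phi> - \<psi>" 0 x 0] assms(2) by (simp add: 0 test_fun_simps)
qed

lift_definition const_test :: "real \<Rightarrow> torus_test" is "\<lambda>c x. c"
  by (rule smooth_periodic_const)

lemma test_deriv_const: "test_deriv (const_test c) = 0"
  by (rule test_deriv_eqI) (simp add: const_test.rep_eq test_fun_zero)

lemma const_test_scaleR: "const_test c = c *\<^sub>R const_test 1"
  by transfer simp

lift_definition translate :: "real \<Rightarrow> torus_test \<Rightarrow> torus_test" is "\<lambda>t \<phi> x. \<phi> (x + t)"
proof -
  fix t \<phi> assume \<phi>: "smooth_periodic \<phi>"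
  have d: "(deriv ^^ n) \<phi> differentiable (at x)" for n x
    using \<phi> by (simp add: smooth_periodic_def)
  have eq: "(deriv ^^ n) (\<lambda>x. \<phi> (x + t)) = (\<lambda>x. (deriv ^^ n) \<phi> (x + t))" for n
  proof (induction n)
    case (Suc n)
    have "((\<lambda>x. (deriv ^^ n) \<phi> (x + t)) has_real_derivative (deriv ^^ Suc n) \<phi> (x + t)) (at x)" for x
      using d[of n "x + t"] by (simp add: DERIV_deriv_iff_real_differentiable flip: DERIV_shift)
    then show ?case
      using Suc DERIV_imp_deriv by fastforce
  qed simp
  have "(\<lambda>x. (deriv ^^ n) \<phi> (x + t)) differentiable (at x)" for n x
    by (rule differentiable_compose[where f = "(deriv ^^ n) \<phi>"]) (use d in auto)
  moreover have "\<phi> (x + 2 * pi + t) = \<phi> (x + t)" for x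
    using \<phi> unfolding smooth_periodic_def by (metis add.commute add.left_commute)
  ultimately show "smooth_periodic (\<lambda>x. \<phi> (x + t))"
    by (simp add: smooth_periodic_def eq)
qed

lemma test_deriv_translate: "test_deriv (translate t \<phi>) = translate t (test_deriv \<phi>)"
  by (rule test_deriv_eqI) (simp add: translate.rep_eq test_fun_has_deriv flip: DERIV_shift)

lemma test_deriv_reflect: "test_deriv (test_reflect \<phi>) = - test_reflect (test_deriv \<phi>)"
proof (rule test_deriv_eqI)
  fix x
  have "((\<lambda>x. test_fun \<phi> (- x)) has_real_derivative test_fun (test_deriv \<phi>) (- x) * - 1) (at x)"
    by (rule DERIV_chain2[OF test_fun_has_deriv]) (auto intro!: derivative_eq_intros)
  then show "(test_fun (test_reflect \<phi>) has_real_derivative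
      test_fun (- test_reflect (test_deriv \<phi>)) x) (at x)"
    by (simp add: test_reflect.rep_eq test_fun_simps)
qed

lemma translate_0: "translate 0 \<phi> = \<phi>"
  by transfer simp

lemma translate_translate: "translate s (translate t \<phi>) = translate (s + t) \<phi>"
  by transfer (simp add: algebra_simps)

lemma translate_period: "translate (of_int n * (2 * pi)) \<phi> = \<phi>"
  by (rule test_fun_eqI) (simp add: translate.rep_eq test_fun_periodic_int)

lemma translate_const: "translate t (const_test c) = const_test c"
  by transfer simp

lemma reflect_translate: "test_reflect (translate t \<phi>) = translate (- t) (test_reflect \<phi>)"
  by transfer simp

lemma reflect_const: "test_reflect (const_test c) = const_test c"
  by transfer simp

lemma linear_translate: "linear (translate t)"
  by (rule linearI) (transfer; simp)+

lemma linear_reflect: "linear test_reflect"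
  by (rule linearI) (transfer; simp)+

section \<open>Mean value and periodic primitive\<close>

definition test_mean :: "torus_test \<Rightarrow> real" where
  "test_mean \<phi> = integral\<^sup>L (lebesgue_on {-pi..pi}) (test_fun \<phi>) / (2 * pi)"

lemma integrable_test_fun: "integrable (lebesgue_on {a..b}) (test_fun \<phi>)"
  by (intro continuous_imp_integrable_real continuous_on_test_fun)

lemma has_integral_test_fun:
  "has_bochner_integral (lebesgue_on {-pi..pi}) (test_fun \<phi>) (2 * pi * test_mean \<phi>)"
  using integrable_test_fun by (simp add: has_bochner_integral_iff test_mean_def)

lemma linear_test_mean: "linear test_mean"
  unfolding test_mean_def
  by (rule linearI) (simp_all add: plus_torus_test.rep_eq scaleR_torus_test.rep_eq
      integrable_test_fun add_divide_distrib)

lemma test_mean_deriv: "test_mean (test_deriv \<phi>) = 0"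
proof -
  have *: "(test_fun (test_deriv \<phi>) has_integral test_fun \<phi> pi - test_fun \<phi> (- pi)) {-pi..pi}"
    by (rule fundamental_theorem_of_calculus)
      (simp_all add: has_field_derivative_at_within[OF test_fun_has_deriv]
        flip: has_real_derivative_iff_has_vector_derivative)
  have per: "test_fun \<phi> pi = test_fun \<phi> (- pi)"
    using test_fun_periodic[of \<phi> "-pi"] by simp
  have "(test_fun (test_deriv \<phi>) has_integral 2 * pi * test_mean (test_deriv \<phi>)) {-pi..pi}"
    using has_integral_integral_lebesgue_on[OF integrable_test_fun[of "-pi" pi "test_deriv \<phi>"]]
    by (simp add: test_mean_def)
  from has_integral_unique[OF this *] show ?thesis
    using per by simp
qed

lemma test_mean_const: "test_mean (const_test c) = c"
  by (simp add: test_mean_def const_test.rep_eq measure_restrict_space)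

lemma primitive_exists: "\<exists>\<Phi>. test_deriv \<Phi> = \<phi> - const_test (test_mean \<phi>) \<and> test_fun \<Phi> 0 = 0"
proof -
  have "\<exists>F. \<forall>x. -\<infinity> < ereal x \<longrightarrow> ereal x < \<infinity> \<longrightarrow> (F has_vector_derivative test_fun \<phi> x) (at x)"
    by (rule einterval_antiderivative) (auto intro: DERIV_isCont test_fun_has_deriv)
  then obtain F where F: "(F has_real_derivative test_fun \<phi> x) (at x)" for x
    by (auto simp: has_real_derivative_iff_has_vector_derivative)
  \<comment> \<open>The slope that makes \<open>F x - m x\<close> periodic is the mean of \<open>\<phi>\<close>.\<close>
  define m where "m = (F pi - F (- pi)) / (2 * pi)"
  define G where "G x = F x - F 0 - m * x" for x
  have G: "(G has_real_derivative test_fun (\<phi> - const_test m) x) (at x)" for x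
    unfolding G_def test_fun_simps const_test.rep_eq
    by (auto intro!: derivative_eq_intros F)
  have "((\<lambda>x. G (x + 2 * pi) - G x) has_real_derivative 0) (at x)" for x
  proof -
    have "((\<lambda>x. G (x + 2 * pi) - G x) has_real_derivative
        test_fun (\<phi> - const_test m) (x + 2 * pi) - test_fun (\<phi> - const_test m) x) (at x)"
      by (intro DERIV_diff G) (use G DERIV_shift in blast)
    then show ?thesis
      by (simp add: test_fun_periodic)
  qed
  then have "G (x + 2 * pi) - G x = G (- pi + 2 * pi) - G (- pi)" for x
    using DERIV_isconst_all[of "\<lambda>x. G (x + 2 * pi) - G x"] by blast
  moreover have "G (- pi + 2 * pi) - G (- pi) = 0"
    by (simp add: G_def m_def)
  ultimately have "G (x + 2 * pi) = G x" for x
    by (metis eq_iff_diff_eq_0)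
  then have "smooth_periodic G"
    using G test_fun_smooth smooth_periodicI by blast
  then have G': "test_fun (Abs_torus_test G) = G"
    by (simp add: Abs_torus_test_inverse)
  then have D: "test_deriv (Abs_torus_test G) = \<phi> - const_test m"
    using G by (simp add: test_deriv_eqI)
  have "test_mean \<phi> = m"
    using test_mean_deriv[of "Abs_torus_test G"] 
    by (simp add: D linear_diff[OF linear_test_mean] test_mean_const)
  then show ?thesis
    using D G' by (metis G_def cancel_comm_monoid_add_class.diff_cancel diff_zero mult_zero_right)
qed

text \<open>The periodic primitive of \<open>\<phi> - mean \<phi>\<close> that vanishes at \<open>0\<close>. Its existence and uniqueness are
  what makes \<open>S\<^sub>t\<close> expressible by translations alone, so that translations are the only operators
  that have to be differentiated in \<open>t\<close>.\<close>

definition test_primitive :: "torus_test \<Rightarrow> torus_test" where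
  "test_primitive \<phi> = (SOME \<Phi>. test_deriv \<Phi> = \<phi> - const_test (test_mean \<phi>) \<and> test_fun \<Phi> 0 = 0)"

lemma test_deriv_primitive: "test_deriv (test_primitive \<phi>) = \<phi> - const_test (test_mean \<phi>)"
  and test_primitive_at_0: "test_fun (test_primitive \<phi>) 0 = 0"
  using someI_ex[OF primitive_exists[of \<phi>]] by (simp_all add: test_primitive_def)

text \<open>The constant \<open>c\<close> is forced to be the mean, since derivatives have mean zero. All the algebra of
  \<open>test_primitive\<close> is read off from this characterisation.\<close>

lemma test_primitive_eqI:
  assumes "test_deriv \<Phi> = \<phi> - const_test c" "test_fun \<Phi> 0 = 0"
  shows "test_primitive \<phi> = \<Phi>"
proof (rule test_fun_eq_if_deriv_eq)
  have "test_mean \<phi> = c"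
    using test_mean_deriv[of \<Phi>] assms(1)
    by (simp add: linear_diff[OF linear_test_mean] test_mean_const)
  then show "test_deriv (test_primitive \<phi>) = test_deriv \<Phi>"
    using assms(1) by (simp add: test_deriv_primitive)
qed (simp add: assms test_primitive_at_0)

lemma linear_const_test: "linear const_test"
  by (rule linearI) (transfer; simp)+

lemma linear_test_primitive: "linear test_primitive"
proof (rule linearI)
  show "test_primitive (\<phi> + \<psi>) = test_primitive \<phi> + test_primitive \<psi>" for \<phi> \<psi>
    by (rule test_primitive_eqI[where c = "test_mean \<phi> + test_mean \<psi>"])
      (simp_all add: linear_add[OF linear_test_deriv] test_deriv_primitive test_fun_simps
        test_primitive_at_0 linear_add[OF linear_const_test])
  show "test_primitive (c *\<^sub>R \<phi>) = c *\<^sub>R test_primitive \<phi>" for c \<phi>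
    by (rule test_primitive_eqI[where c = "c * test_mean \<phi>"])
      (simp_all add: linear_scale[OF linear_test_deriv] test_deriv_primitive test_fun_simps
        test_primitive_at_0 linear_scale[OF linear_const_test, symmetric]
        scaleR_diff_right)
qed

lemma test_primitive_deriv: "test_primitive (test_deriv \<phi>) = \<phi> - const_test (test_fun \<phi> 0)"
  by (rule test_primitive_eqI[where c = 0])
    (simp_all add: linear_diff[OF linear_test_deriv] test_deriv_const test_fun_simps
      const_test.rep_eq linear_0[OF linear_const_test])

lemma test_mean_reflect: "test_mean (test_reflect \<phi>) = test_mean \<phi>"
proof -
  have "has_bochner_integral (lebesgue_on {-pi..pi}) (\<lambda>x. test_fun \<phi> (- x)) (2 * pi * test_mean \<phi>)"
    using has_bochner_integral_reflect_real_lemma[OF has_integral_test_fun] by simp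
  moreover have "has_bochner_integral (lebesgue_on {-pi..pi}) (\<lambda>x. test_fun \<phi> (- x))
      (2 * pi * test_mean (test_reflect \<phi>))"
    using has_integral_test_fun[of "test_reflect \<phi>"] by (simp add: test_reflect.rep_eq)
  ultimately have "2 * pi * test_mean (test_reflect \<phi>) = 2 * pi * test_mean \<phi>"
    by (metis has_bochner_integral_eq)
  then show ?thesis by simp
qed

lemma test_primitive_reflect: "test_primitive (test_reflect \<phi>) = - test_reflect (test_primitive \<phi>)"
  by (rule test_primitive_eqI[where c = "test_mean \<phi>"])
    (simp_all add: linear_neg[OF linear_test_deriv] test_deriv_reflect test_deriv_primitive
      test_fun_simps test_reflect.rep_eq test_primitive_at_0 linear_diff[OF linear_reflect] reflect_const)

text \<open>A periodic function has a critical point, where its derivative \<open>\<phi> - mean \<phi>\<close> vanishes: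
  so the mean is a value of \<open>\<phi>\<close>.\<close>

lemma test_mean_le:
  assumes "\<And>x. \<bar>test_fun \<phi> x\<bar> \<le> M"
  shows "\<bar>test_mean \<phi>\<bar> \<le> M"
proof -
  let ?P = "test_primitive \<phi>"
  have "test_fun ?P (2 * pi) = test_fun ?P 0"
    using test_fun_periodic[of ?P 0] by simp
  then obtain z where "(test_fun ?P has_real_derivative 0) (at z)"
    using Rolle[of 0 "2 * pi" "test_fun ?P"] continuous_on_test_fun test_fun_has_deriv[of ?P]
      real_differentiable_def by (metis mult_pos_pos pi_gt_zero zero_less_numeral)
  then have "test_fun (test_deriv ?P) z = 0"
    using DERIV_unique test_fun_has_deriv by blast
  then have "test_mean \<phi> = test_fun \<phi> z"
    by (simp add: test_deriv_primitive test_fun_simps const_test.rep_eq)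
  then show ?thesis using assms by simp
qed

lemma test_primitive_le:
  assumes M: "\<And>x. \<bar>test_fun \<phi> x\<bar> \<le> M"
  shows "\<bar>test_fun (test_primitive \<phi>) x\<bar> \<le> 4 * pi * M"
proof -
  have "\<bar>test_fun (test_deriv (test_primitive \<phi>)) z\<bar> \<le> 2 * M" for z
    using M[of z] test_mean_le[OF M]
    by (simp add: test_deriv_primitive test_fun_simps const_test.rep_eq)
  then have *: "\<bar>test_fun (test_primitive \<phi>) y - test_fun (test_primitive \<phi>) 0\<bar> \<le> 2 * M * \<bar>y - 0\<bar>" for y
    by (rule test_fun_lipschitz)
  obtain n y where x: "x = y + of_int n * (2 * pi)" "0 \<le> y" "y < 2 * pi"
    by (rule torus_representative)
  have "M \<ge> 0" using M[of 0] by linarith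
  then have "2 * M * \<bar>y\<bar> \<le> 2 * M * (2 * pi)"
    using x by (intro mult_left_mono) auto
  then show ?thesis
    using *[of y] unfolding x(1) test_fun_periodic_int test_primitive_at_0 by (simp add: mult_ac)
qed

section \<open>Continuous operators on test functions\<close>

text \<open>The operators that can be transposed to distributions.\<close>

definition test_operator :: "(torus_test \<Rightarrow> torus_test) \<Rightarrow> bool" where
  "test_operator L \<longleftrightarrow> linear L \<and> (\<forall>X \<phi>. test_tendsto X \<phi> \<longrightarrow> test_tendsto (\<lambda>n. L (X n)) (L \<phi>))"

lemma funpow_linear: "linear (f :: 'a::real_vector \<Rightarrow> 'a) \<Longrightarrow> linear (f ^^ k)"
  by (induction k) (auto intro: linear_compose linear_id[unfolded id_def] simp: linear_id)

lemma test_tendsto_bounds_iff: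
  "test_tendsto X \<phi> \<longleftrightarrow> (\<forall>k. \<forall>e>0. \<forall>\<^sub>F n in sequentially. 
     \<forall>x. \<bar>test_fun ((test_deriv ^^ k) (X n - \<phi>)) x\<bar> \<le> e)"
  (is "_ \<longleftrightarrow> ?R")
proof -
  have eq: "test_fun ((test_deriv ^^ k) (X n - \<phi>)) x =
      test_fun ((test_deriv ^^ k) (X n)) x - test_fun ((test_deriv ^^ k) \<phi>) x" for k n x
    by (simp add: linear_diff[OF funpow_linear[OF linear_test_deriv]] test_fun_simps)
  have "test_tendsto X \<phi> \<longleftrightarrow> (\<forall>k. \<forall>e>0. \<forall>\<^sub>F n in sequentially. 
     \<forall>x. \<bar>test_fun ((test_deriv ^^ k) (X n - \<phi>)) x\<bar> < e)"
    by (simp add: test_tendsto_iff uniform_limit_iff eq dist_real_def)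
  also have "\<dots> \<longleftrightarrow> ?R"
  proof (intro iffI allI impI)
    fix k and e :: real
    assume L: "\<forall>k. \<forall>e>0. \<forall>\<^sub>F n in sequentially. \<forall>x. \<bar>test_fun ((test_deriv ^^ k) (X n - \<phi>)) x\<bar> < e"
      and "e > 0"
    then have "\<forall>\<^sub>F n in sequentially. \<forall>x. \<bar>test_fun ((test_deriv ^^ k) (X n - \<phi>)) x\<bar> < e"
      by blast
    then show "\<forall>\<^sub>F n in sequentially. \<forall>x. \<bar>test_fun ((test_deriv ^^ k) (X n - \<phi>)) x\<bar> \<le> e"
      by (rule eventually_mono) (simp add: less_imp_le)
  next
    fix k and e :: real
    assume R: ?R and "e > 0"
    then have "\<forall>\<^sub>F n in sequentially. \<forall>x. \<bar>test_fun ((test_deriv ^^ k) (X n - \<phi>)) x\<bar> \<le> e / 2"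
      using half_gt_zero by blast
    then show "\<forall>\<^sub>F n in sequentially. \<forall>x. \<bar>test_fun ((test_deriv ^^ k) (X n - \<phi>)) x\<bar> < e"
    proof (rule eventually_mono, intro allI)
      fix n x assume "\<forall>x. \<bar>test_fun ((test_deriv ^^ k) (X n - \<phi>)) x\<bar> \<le> e / 2"
      moreover have "e / 2 < e" using \<open>e > 0\<close> by simp
      ultimately show "\<bar>test_fun ((test_deriv ^^ k) (X n - \<phi>)) x\<bar> < e"
        by (meson le_less_trans)
    qed
  qed
  finally show ?thesis .
qed

text \<open>The suprema of the derivatives are the seminorms that define \<open>C\<^sup>\<infinity>\<close>, so estimates between them give
  continuity.\<close>

lemma test_operatorI:
  assumes "linear L"
    and bound: "\<And>k. \<exists>j C. C > 0 \<and> (\<forall>\<phi> M. (\<forall>x. \<bar>test_fun ((test_deriv ^^ j) \<phi>) x\<bar> \<le> M) \<longrightarrow>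
      (\<forall>x. \<bar>test_fun ((test_deriv ^^ k) (L \<phi>)) x\<bar> \<le> C * M))"
  shows "test_operator L"
  unfolding test_operator_def
proof (intro conjI allI impI)
  fix X \<phi> assume X: "test_tendsto X \<phi>"
  show "test_tendsto (\<lambda>n. L (X n)) (L \<phi>)"
    unfolding test_tendsto_bounds_iff
  proof (intro allI impI)
    fix k and e :: real assume "e > 0"
    obtain j C where C: "C > 0"
      "\<forall>\<phi> M. (\<forall>x. \<bar>test_fun ((test_deriv ^^ j) \<phi>) x\<bar> \<le> M) \<longrightarrow>
        (\<forall>x. \<bar>test_fun ((test_deriv ^^ k) (L \<phi>)) x\<bar> \<le> C * M)"
      using bound[of k] by (elim exE conjE) (rule that)
    have "\<forall>\<^sub>F n in sequentially. \<forall>x. \<bar>test_fun ((test_deriv ^^ j) (X n - \<phi>)) x\<bar> \<le> e / C"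
      using X \<open>e > 0\<close> C by (simp add: test_tendsto_bounds_iff)
    then show "\<forall>\<^sub>F n in sequentially. \<forall>x. \<bar>test_fun ((test_deriv ^^ k) (L (X n) - L \<phi>)) x\<bar> \<le> e"
    proof (rule eventually_mono, intro allI)
      fix n x assume "\<forall>x. \<bar>test_fun ((test_deriv ^^ j) (X n - \<phi>)) x\<bar> \<le> e / C"
      then show "\<bar>test_fun ((test_deriv ^^ k) (L (X n) - L \<phi>)) x\<bar> \<le> e"
        using C(2)[rule_format, of "X n - \<phi>" "e / C" x] \<open>C > 0\<close> by (simp add: linear_diff[OF \<open>linear L\<close>])
    qed
  qed
qed fact

lemma test_operator_linear: "test_operator L \<Longrightarrow> linear L"
  by (simp add: test_operator_def)

lemma test_operator_id: "test_operator (\<lambda>\<phi>. \<phi>)"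
  by (simp add: test_operator_def linear_id[unfolded id_def])

lemma test_operator_compose:
  "test_operator L \<Longrightarrow> test_operator K \<Longrightarrow> test_operator (\<lambda>\<phi>. L (K \<phi>))"
  using linear_compose[of K L] by (auto simp: test_operator_def o_def)

lemma test_operator_add:
  assumes "test_operator L" "test_operator K"
  shows "test_operator (\<lambda>\<phi>. L \<phi> + K \<phi>)"
  unfolding test_operator_def
proof (intro conjI allI impI)
  show "linear (\<lambda>\<phi>. L \<phi> + K \<phi>)"
    using assms by (auto simp: test_operator_def intro: linear_compose_add)
  fix X \<phi> assume "test_tendsto X \<phi>"
  then have "test_tendsto (\<lambda>n. L (X n)) (L \<phi>)" "test_tendsto (\<lambda>n. K (X n)) (K \<phi>)"
    using assms by (auto simp: test_operator_def)
  then show "test_tendsto (\<lambda>n. L (X n) + K (X n)) (L \<phi> + K \<phi>)"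
    by (auto simp: test_tendsto_iff linear_add[OF funpow_linear[OF linear_test_deriv]]
        plus_torus_test.rep_eq intro!: uniform_limit_add)
qed

lemma test_operator_scaleR: "test_operator (\<lambda>\<phi>. c *\<^sub>R \<phi>)"
proof (rule test_operatorI)
  fix k
  have "\<bar>c * y\<bar> \<le> (\<bar>c\<bar> + 1) * M" if "\<bar>y\<bar> \<le> M" for y M
    using that by (auto simp: abs_mult intro!: mult_mono)
  then have "(\<forall>x. \<bar>test_fun ((test_deriv ^^ k) \<phi>) x\<bar> \<le> M) \<longrightarrow>
      (\<forall>x. \<bar>test_fun ((test_deriv ^^ k) (c *\<^sub>R \<phi>)) x\<bar> \<le> (\<bar>c\<bar> + 1) * M)" for \<phi> M
    by (simp add: linear_scale[OF funpow_linear[OF linear_test_deriv]] test_fun_simps)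
  moreover have "\<bar>c\<bar> + 1 > 0" by simp
  ultimately show "\<exists>j C. C > 0 \<and> (\<forall>\<phi> M. (\<forall>x. \<bar>test_fun ((test_deriv ^^ j) \<phi>) x\<bar> \<le> M) \<longrightarrow>
      (\<forall>x. \<bar>test_fun ((test_deriv ^^ k) (c *\<^sub>R \<phi>)) x\<bar> \<le> C * M))"
    by blast
qed (simp add: linear_iff algebra_simps)

lemma test_operator_diff:
  assumes "test_operator L" "test_operator K"
  shows "test_operator (\<lambda>\<phi>. L \<phi> - K \<phi>)"
  using test_operator_add[OF assms(1) test_operator_compose[OF test_operator_scaleR[of "-1"] assms(2)]]
  by simp

lemma test_operator_deriv: "test_operator test_deriv"
  by (simp add: test_operator_def linear_test_deriv test_tendsto_deriv)

lemma funpow_deriv_translate: "(test_deriv ^^ k) (translate t \<phi>) = translate t ((test_deriv ^^ k) \<phi>)"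
  by (induction k) (simp_all add: test_deriv_translate)

lemma test_operator_translate: "test_operator (translate t)"
proof (rule test_operatorI[OF linear_translate])
  fix k
  show "\<exists>j C. C > 0 \<and> (\<forall>\<phi> M. (\<forall>x. \<bar>test_fun ((test_deriv ^^ j) \<phi>) x\<bar> \<le> M) \<longrightarrow>
      (\<forall>x. \<bar>test_fun ((test_deriv ^^ k) (translate t \<phi>)) x\<bar> \<le> C * M))"
    by (rule exI[of _ k], rule exI[of _ 1]) (auto simp: funpow_deriv_translate translate.rep_eq)
qed

lemma test_operator_mean: "test_operator (\<lambda>\<phi>. const_test (test_mean \<phi>))"
proof (rule test_operatorI)
  show "linear (\<lambda>\<phi>. const_test (test_mean \<phi>))"
    using linear_compose[OF linear_test_mean linear_const_test] by (simp add: o_def)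
  fix k
  have "(test_deriv ^^ k) (const_test c) = (if k = 0 then const_test c else 0)" for c
    by (induction k) (auto simp: test_deriv_const linear_0[OF linear_test_deriv])
  then show "\<exists>j C. C > 0 \<and> (\<forall>\<phi> M. (\<forall>x. \<bar>test_fun ((test_deriv ^^ j) \<phi>) x\<bar> \<le> M) \<longrightarrow>
      (\<forall>x. \<bar>test_fun ((test_deriv ^^ k) (const_test (test_mean \<phi>))) x\<bar> \<le> C * M))"
    using test_mean_le
    by (intro exI[of _ 0] exI[of _ 1])
      (auto simp: test_fun_simps const_test.rep_eq intro: order_trans[OF abs_ge_zero])
qed

lemma test_operator_primitive: "test_operator test_primitive"
  unfolding test_operator_def
proof (intro conjI allI impI linear_test_primitive)
  fix X \<phi> assume X: "test_tendsto X \<phi>"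
  show "test_tendsto (\<lambda>n. test_primitive (X n)) (test_primitive \<phi>)"
    unfolding test_tendsto_bounds_iff
  proof (intro allI impI)
    fix k and e :: real assume "e > 0"
    show "\<forall>\<^sub>F n in sequentially.
        \<forall>x. \<bar>test_fun ((test_deriv ^^ k) (test_primitive (X n) - test_primitive \<phi>)) x\<bar> \<le> e"
    proof (cases k)
      case 0
      have "\<forall>\<^sub>F n in sequentially. \<forall>x. \<bar>test_fun ((test_deriv ^^ 0) (X n - \<phi>)) x\<bar> \<le> e / (4 * pi)"
        using X[unfolded test_tendsto_bounds_iff, rule_format, of "e / (4 * pi)" 0] \<open>e > 0\<close> by simp
      then show ?thesis
      proof (rule eventually_mono, intro allI)
        fix n x assume "\<forall>x. \<bar>test_fun ((test_deriv ^^ 0) (X n - \<phi>)) x\<bar> \<le> e / (4 * pi)"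
        then show "\<bar>test_fun ((test_deriv ^^ k) (test_primitive (X n) - test_primitive \<phi>)) x\<bar> \<le> e"
          using test_primitive_le[of "X n - \<phi>" "e / (4 * pi)" x]
          by (simp add: 0 linear_diff[OF linear_test_primitive])
      qed
    next
      \<comment> \<open>Higher derivatives of a primitive are derivatives of \<open>\<phi> - mean \<phi>\<close>.\<close>
      case (Suc j)
      have "test_tendsto (\<lambda>n. X n - const_test (test_mean (X n))) (\<phi> - const_test (test_mean \<phi>))"
        using test_operator_diff[OF test_operator_id test_operator_mean] X
        by (simp add: test_operator_def)
      then show ?thesis
        using \<open>e > 0\<close> 
        by (simp add: test_tendsto_bounds_iff Suc funpow_swap1 test_deriv_primitive
            linear_diff[OF linear_test_deriv])
    qed
  qed
qed

section \<open>Distributions\<close>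

lemma distribution_eqI: "(\<And>\<phi>. pairing F \<phi> = pairing G \<phi>) \<Longrightarrow> F = G"
  using pairing_inject by blast

lemma linear_pairing: "linear (pairing F)"
  and pairing_tendsto: "test_tendsto X \<phi> \<Longrightarrow> (\<lambda>n. pairing F (X n)) \<longlonglongrightarrow> pairing F \<phi>"
  using pairing[of F] by auto

lemma pairing_plus: "pairing (F + G) \<phi> = pairing F \<phi> + pairing G \<phi>"
  by (simp add: plus_torus_distribution.rep_eq)

lemma pairing_0: "pairing 0 \<phi> = 0"
  by (simp add: zero_torus_distribution.rep_eq)

lemma pairing_scaleR: "pairing (c *\<^sub>R F) \<phi> = c * pairing F \<phi>"
  by (simp add: scaleR_torus_distribution.rep_eq)

lemma pairing_dirac: "pairing dirac \<phi> = test_fun \<phi> 0"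
  by (simp add: dirac.rep_eq)

lemma pairing_deriv: "pairing (dist_deriv F) \<phi> = - pairing F (test_deriv \<phi>)"
  by (simp add: dist_deriv.rep_eq)

lemmas test_linear =
  linear_add[OF linear_pairing] linear_diff[OF linear_pairing]
  linear_scale[OF linear_pairing] linear_neg[OF linear_pairing]
  linear_add[OF linear_test_deriv] linear_diff[OF linear_test_deriv]
  linear_scale[OF linear_test_deriv] linear_neg[OF linear_test_deriv]
  linear_add[OF linear_translate] linear_diff[OF linear_translate]
  linear_scale[OF linear_translate] linear_neg[OF linear_translate]
  linear_add[OF linear_reflect] linear_diff[OF linear_reflect]
  linear_scale[OF linear_reflect] linear_neg[OF linear_reflect]
  linear_add[OF linear_test_mean] linear_diff[OF linear_test_mean]
  linear_scale[OF linear_test_mean] linear_neg[OF linear_test_mean]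
  linear_add[OF linear_test_primitive] linear_diff[OF linear_test_primitive]
  linear_scale[OF linear_test_primitive] linear_neg[OF linear_test_primitive]

text \<open>Meaningful only for a \<open>test_operator\<close>, as in \<open>pairing_transpose\<close>; for any other \<open>L\<close> the
  abstraction function is applied outside its domain.\<close>

definition dist_transpose :: "(torus_test \<Rightarrow> torus_test) \<Rightarrow> torus_distribution \<Rightarrow> torus_distribution"
  where "dist_transpose L F = Abs_torus_distribution (\<lambda>\<phi>. pairing F (L \<phi>))"

lemma pairing_transpose:
  assumes "test_operator L"
  shows "pairing (dist_transpose L F) \<phi> = pairing F (L \<phi>)"
proof -
  have "linear (\<lambda>\<phi>. pairing F (L \<phi>))"
    using linear_compose[OF test_operator_linear[OF assms] linear_pairing[of F]] by (simp add: o_def)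
  moreover have "(\<lambda>n. pairing F (L (X n))) \<longlonglongrightarrow> pairing F (L \<phi>)" if "test_tendsto X \<phi>" for X \<phi>
    using that assms pairing_tendsto by (auto simp: test_operator_def)
  ultimately show ?thesis
    by (simp add: dist_transpose_def Abs_torus_distribution_inverse)
qed

text \<open>The supremum norm is one of the seminorms of \<open>C\<^sup>\<infinity>\<close>, so boundedness in it already gives continuity;
  the functionals obtained in this way are the measures.\<close>

lemma distributionI:
  assumes "linear J" and bound: "\<And>\<phi> M. (\<And>x. \<bar>test_fun \<phi> x\<bar> \<le> M) \<Longrightarrow> \<bar>J \<phi>\<bar> \<le> C * M"
  shows "pairing (Abs_torus_distribution J) = J"
proof -
  have "(\<lambda>n. J (X n)) \<longlonglongrightarrow> J \<phi>" if X: "test_tendsto X \<phi>" for X \<phi>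
  proof (rule LIMSEQ_I)
    fix r :: real assume "r > 0"
    define K where "K = \<bar>C\<bar> + 1"
    define e where "e = r / (2 * K)"
    have "K > 0" "C \<le> K" by (auto simp: K_def)
    then have "e > 0" using \<open>r > 0\<close> by (simp add: e_def)
    then have "\<forall>\<^sub>F n in sequentially. \<forall>x. \<bar>test_fun ((test_deriv ^^ 0) (X n - \<phi>)) x\<bar> \<le> e"
      using X unfolding test_tendsto_bounds_iff by blast
    then have "\<forall>\<^sub>F n in sequentially. \<bar>J (X n) - J \<phi>\<bar> < r"
    proof (rule eventually_mono)
      fix n assume "\<forall>x. \<bar>test_fun ((test_deriv ^^ 0) (X n - \<phi>)) x\<bar> \<le> e"
      then have "\<bar>J (X n) - J \<phi>\<bar> \<le> C * e"
        using bound[of "X n - \<phi>" e] by (simp add: linear_diff[OF \<open>linear J\<close>])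
      also have "\<dots> \<le> K * e"
        using \<open>e > 0\<close> \<open>C \<le> K\<close> by (intro mult_right_mono) auto
      also have "\<dots> = r / 2"
        using \<open>K > 0\<close> by (simp add: e_def)
      finally show "\<bar>J (X n) - J \<phi>\<bar> < r"
        using \<open>r > 0\<close> by simp
    qed
    then show "\<exists>N. \<forall>n\<ge>N. norm (J (X n) - J \<phi>) < r"
      by (simp add: eventually_sequentially)
  qed
  then show ?thesis
    using \<open>linear J\<close> by (simp add: Abs_torus_distribution_inverse)
qed

text \<open>Difference quotients of translations converge in \<open>C\<^sup>\<infinity>\<close>: two applications of the mean
  value theorem give an error \<open>\<bar>h\<bar> sup \<bar>\<phi>''\<bar>\<close>, for \<open>\<phi>\<close> and for each of its derivatives.\<close>

lemma difference_quotient_le: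
  assumes M: "\<And>x. \<bar>test_fun (test_deriv (test_deriv \<phi>)) x\<bar> \<le> M" and "h \<noteq> 0"
  shows "\<bar>test_fun ((1 / h) *\<^sub>R (translate h \<phi> - \<phi>) - test_deriv \<phi>) x\<bar> \<le> M * \<bar>h\<bar>"
proof -
  let ?D = "test_fun (test_deriv \<phi>)"
  have "norm ((test_fun \<phi> (x + h) - ?D x * (x + h)) - (test_fun \<phi> x - ?D x * x)) \<le>
      (M * \<bar>h\<bar>) * norm (x + h - x)"
  proof (rule field_differentiable_bound[of "cball x \<bar>h\<bar>" _ "\<lambda>y. ?D y - ?D x"])
    fix y assume y: "y \<in> cball x \<bar>h\<bar>"
    show "((\<lambda>y. test_fun \<phi> y - ?D x * y) has_real_derivative ?D y - ?D x) (at y within cball x \<bar>h\<bar>)"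
      by (rule has_field_derivative_at_within) (auto intro!: derivative_eq_intros test_fun_has_deriv)
    have "M \<ge> 0" using M[of 0] by linarith
    then have "M * \<bar>y - x\<bar> \<le> M * \<bar>h\<bar>"
      using y by (intro mult_left_mono) (auto simp: dist_real_def)
    then show "norm (?D y - ?D x) \<le> M * \<bar>h\<bar>"
      using test_fun_lipschitz[OF M, of y x] by simp
  qed (auto simp: dist_real_def)
  then have "\<bar>h * test_fun ((1 / h) *\<^sub>R (translate h \<phi> - \<phi>) - test_deriv \<phi>) x\<bar> \<le> M * \<bar>h\<bar> * \<bar>h\<bar>"
    using \<open>h \<noteq> 0\<close> by (simp add: test_fun_simps translate.rep_eq algebra_simps)
  then have "\<bar>h\<bar> * \<bar>test_fun ((1 / h) *\<^sub>R (translate h \<phi> - \<phi>) - test_deriv \<phi>) x\<bar> \<le> \<bar>h\<bar> * (M * \<bar>h\<bar>)"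
    by (simp only: abs_mult mult_ac)
  then show ?thesis
    by (rule mult_left_le_imp_le) (use \<open>h \<noteq> 0\<close> in simp)
qed

lemma test_tendsto_difference_quotient:
  assumes "h \<longlonglongrightarrow> 0" and "\<And>n. h n \<noteq> 0"
  shows "test_tendsto (\<lambda>n. (1 / h n) *\<^sub>R (translate (h n) \<phi> - \<phi>)) (test_deriv \<phi>)"
  unfolding test_tendsto_bounds_iff
proof (intro allI impI)
  fix k and e :: real assume "e > 0"
  obtain M where M: "M \<ge> 0" "\<And>x. \<bar>test_fun (test_deriv (test_deriv ((test_deriv ^^ k) \<phi>))) x\<bar> \<le> M"
    using test_fun_bounded by blast
  have "\<forall>\<^sub>F n in sequentially. \<bar>h n\<bar> < e / (M + 1)"
    using assms(1) \<open>e > 0\<close> \<open>M \<ge> 0\<close> tendstoD[of h 0 sequentially "e / (M + 1)"]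
    by (simp add: dist_real_def)
  then show "\<forall>\<^sub>F n in sequentially. \<forall>x.
      \<bar>test_fun ((test_deriv ^^ k) ((1 / h n) *\<^sub>R (translate (h n) \<phi> - \<phi>) - test_deriv \<phi>)) x\<bar> \<le> e"
  proof (rule eventually_mono, intro allI)
    fix n x assume n: "\<bar>h n\<bar> < e / (M + 1)"
    note lin = funpow_linear[OF linear_test_deriv, of k]
    have "\<bar>test_fun ((test_deriv ^^ k) ((1 / h n) *\<^sub>R (translate (h n) \<phi> - \<phi>) - test_deriv \<phi>)) x\<bar>
        \<le> M * \<bar>h n\<bar>"
      using difference_quotient_le[OF M(2) assms(2)]
      by (simp add: linear_diff[OF lin] linear_scale[OF lin] funpow_deriv_translate
          funpow_swap1[of test_deriv k])
    also have "\<dots> \<le> (M + 1) * \<bar>h n\<bar>"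
      by (intro mult_right_mono) auto
    also have "\<dots> \<le> e"
      using n \<open>M \<ge> 0\<close> by (simp add: field_simps)
    finally show "\<bar>test_fun ((test_deriv ^^ k) ((1 / h n) *\<^sub>R (translate (h n) \<phi> - \<phi>) - test_deriv \<phi>)) x\<bar> \<le> e" .
  qed
qed

lemma pairing_translate_has_deriv:
  "((\<lambda>t. pairing F (translate t \<phi>)) has_real_derivative pairing F (translate t (test_deriv \<phi>))) (at t)"
  unfolding DERIV_def tendsto_at_iff_sequentially
proof (intro allI impI)
  fix h :: "nat \<Rightarrow> real" assume h: "\<forall>i. h i \<in> UNIV - {0}" "h \<longlonglongrightarrow> 0"
  have "(\<lambda>n. pairing F ((1 / h n) *\<^sub>R (translate (h n) (translate t \<phi>) - translate t \<phi>)))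
      \<longlonglongrightarrow> pairing F (test_deriv (translate t \<phi>))"
    by (intro pairing_tendsto test_tendsto_difference_quotient) (use h in auto)
  then show "((\<lambda>h. (pairing F (translate (t + h) \<phi>) - pairing F (translate t \<phi>)) / h) \<circ> h)
      \<longlonglongrightarrow> pairing F (translate t (test_deriv \<phi>))"
    by (simp add: o_def translate_translate test_linear test_deriv_translate add.commute)
qed

lemma pairing_translate_neg_has_deriv:
  "((\<lambda>t. pairing F (translate (- t) \<phi>)) has_real_derivative
     - pairing F (translate (- t) (test_deriv \<phi>))) (at t)"
proof -
  have "((\<lambda>t. pairing F (translate (- t) \<phi>)) has_real_derivative
      pairing F (translate (- t) (test_deriv \<phi>)) * - 1) (at t)"
    by (rule DERIV_chain2[where f = "\<lambda>t. pairing F (translate t \<phi>)" and g = uminus])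
      (auto intro!: derivative_eq_intros pairing_translate_has_deriv)
  then show ?thesis by simp
qed

section \<open>The wave group\<close>

text \<open>The even and odd parts of the translation group, \<open>cosh tD\<close> and \<open>sinh tD / D\<close>. The first summand of
  \<open>wave_sin\<close> is \<open>\<integral>\<^sub>0\<^sup>t cosh sD ds\<close> on constants, where \<open>D\<close> cannot be inverted.\<close>

definition wave_cos :: "real \<Rightarrow> torus_test \<Rightarrow> torus_test" where
  "wave_cos t \<phi> = (1 / 2) *\<^sub>R (translate t \<phi> + translate (- t) \<phi>)"

definition wave_sin :: "real \<Rightarrow> torus_test \<Rightarrow> torus_test" where
  "wave_sin t \<phi> = (t * test_mean \<phi>) *\<^sub>R const_test 1 +
     (1 / 2) *\<^sub>R (translate t (test_primitive \<phi>) - translate (- t) (test_primitive \<phi>))"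

lemma wave_sin_deriv: "wave_sin t (test_deriv \<phi>) = (1 / 2) *\<^sub>R (translate t \<phi> - translate (- t) \<phi>)"
  by (simp add: wave_sin_def test_mean_deriv test_primitive_deriv test_linear translate_const)

lemma test_operator_cos: "test_operator (wave_cos t)"
  unfolding wave_cos_def
  by (intro test_operator_compose[OF test_operator_scaleR] test_operator_add test_operator_translate)

lemma test_operator_sin: "test_operator (wave_sin t)"
proof -
  have "test_operator (\<lambda>\<phi>. t *\<^sub>R const_test (test_mean \<phi>) +
     (1 / 2) *\<^sub>R (translate t (test_primitive \<phi>) - translate (- t) (test_primitive \<phi>)))"
    by (intro test_operator_compose[OF test_operator_scaleR] test_operator_add test_operator_diff
        test_operator_compose[OF test_operator_translate] test_operator_primitive test_operator_mean)
  then show ?thesis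
    unfolding wave_sin_def by (subst (asm) const_test_scaleR) simp
qed

lemma wave_cos_reflect: "wave_cos t (test_reflect \<phi>) = test_reflect (wave_cos t \<phi>)"
  by (simp add: wave_cos_def test_linear reflect_translate add.commute)

lemma wave_sin_reflect: "wave_sin t (test_reflect \<phi>) = test_reflect (wave_sin t \<phi>)"
  by (simp add: wave_sin_def test_linear reflect_translate test_mean_reflect test_primitive_reflect
      reflect_const)

definition wave :: "real \<Rightarrow> string_state \<Rightarrow> string_state" where
  "wave t f =
     (dist_transpose (wave_cos t) (fst f) + dist_transpose (wave_sin t) (snd f),
      dist_transpose (\<lambda>\<phi>. wave_sin t (test_deriv (test_deriv \<phi>))) (fst f) +
        dist_transpose (wave_cos t) (snd f))"

lemma pairing_wave:
  "pairing (fst (wave t f)) \<phi> = pairing (fst f) (wave_cos t \<phi>) + pairing (snd f) (wave_sin t \<phi>)"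
  "pairing (snd (wave t f)) \<phi> =
     pairing (fst f) (wave_sin t (test_deriv (test_deriv \<phi>))) + pairing (snd f) (wave_cos t \<phi>)"
  by (simp_all add: wave_def pairing_plus pairing_transpose test_operator_cos test_operator_sin
      test_operator_compose[OF test_operator_sin test_operator_compose[OF test_operator_deriv test_operator_deriv]])

lemma wave_cos_0: "wave_cos 0 \<phi> = \<phi>"
  by (simp add: wave_cos_def translate_0 flip: scaleR_left_distrib) 

lemma wave_sin_0: "wave_sin 0 \<phi> = 0"
  by (simp add: wave_sin_def)

lemma wave_0: "wave 0 f = f"
  by (intro prod_eqI distribution_eqI)
    (simp_all add: pairing_wave wave_cos_0 wave_sin_0 linear_0[OF linear_pairing])

lemma state_space_iff:
  "f \<in> state_space \<longleftrightarrow> even_distribution (fst f) \<and> even_distribution (snd f)"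
  by (cases f) (simp add: state_space_def)

lemma wave_in_state_space: "f \<in> state_space \<Longrightarrow> wave t f \<in> state_space"
  by (simp add: state_space_iff even_distribution_def pairing_wave wave_cos_reflect wave_sin_reflect
      test_deriv_reflect test_linear)

lemma pairing_wave_cos_has_deriv:
  "((\<lambda>t. pairing F (wave_cos t \<phi>)) has_real_derivative pairing F (wave_sin t (test_deriv (test_deriv \<phi>)))) (at t)"
  unfolding wave_cos_def wave_sin_deriv test_linear
  by (auto intro!: derivative_eq_intros pairing_translate_has_deriv pairing_translate_neg_has_deriv
      simp: algebra_simps)

text \<open>Differentiating the translations of \<open>P \<phi>\<close> produces \<open>\<phi> - mean \<phi>\<close>, and the missing mean is the
  derivative of the linear term.\<close>

lemma pairing_wave_sin_has_deriv:
  "((\<lambda>t. pairing F (wave_sin t \<phi>)) has_real_derivative pairing F (wave_cos t \<phi>)) (at t)"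
proof -
  have "((\<lambda>t. pairing F (wave_sin t \<phi>)) has_real_derivative
      test_mean \<phi> * pairing F (const_test 1) + 
      1 / 2 * (pairing F (translate t (\<phi> - const_test (test_mean \<phi>))) 
        - - pairing F (translate (- t) (\<phi> - const_test (test_mean \<phi>))))) (at t)"
    unfolding wave_sin_def test_linear test_deriv_primitive[symmetric]
    by (auto intro!: derivative_eq_intros pairing_translate_has_deriv pairing_translate_neg_has_deriv
        simp: algebra_simps)
  moreover have "test_mean \<phi> * pairing F (const_test 1) + 
      1 / 2 * (pairing F (translate t (\<phi> - const_test (test_mean \<phi>))) 
        - - pairing F (translate (- t) (\<phi> - const_test (test_mean \<phi>)))) = pairing F (wave_cos t \<phi>)"
    by (subst (1 2) const_test_scaleR) (simp add: wave_cos_def test_linear translate_const algebra_simps)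
  ultimately show ?thesis by simp
qed

lemma wave_has_deriv: "has_weak_derivative (\<lambda>t. wave t f) (op_A (wave t f)) t"
proof -
  have "((\<lambda>t. pairing (fst (wave t f)) \<phi>) has_real_derivative pairing (fst (op_A (wave t f))) \<phi>) (at t)" for \<phi>
    unfolding pairing_wave op_A_def fst_conv
    by (intro DERIV_add pairing_wave_cos_has_deriv pairing_wave_sin_has_deriv)
  moreover have "((\<lambda>t. pairing (snd (wave t f)) \<phi>) has_real_derivative pairing (snd (op_A (wave t f))) \<phi>) (at t)" for \<phi>
    unfolding pairing_wave op_A_def snd_conv pairing_deriv minus_minus
    by (intro DERIV_add pairing_wave_cos_has_deriv pairing_wave_sin_has_deriv)
  ultimately show ?thesis
    by (simp add: has_weak_derivative_def)
qed

section \<open>Density of trigonometric polynomials\<close>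

lemma smooth_periodic_trig:
  "smooth_periodic (\<lambda>x. a * cos (of_int n * x) + b * sin (of_int n * x))"
proof -
  have d: "((\<lambda>x. a * cos (of_int n * x) + b * sin (of_int n * x)) has_real_derivative
      of_int n * b * cos (of_int n * x) + (- of_int n * a) * sin (of_int n * x)) (at x)" for a b x
    by (auto intro!: derivative_eq_intros)
  have "(deriv ^^ k) (\<lambda>x. a * cos (of_int n * x) + b * sin (of_int n * x)) differentiable (at x)" for k x
  proof (induction k arbitrary: a b)
    case 0
    then show ?case using d real_differentiable_def by auto
  next
    case (Suc k)
    have "deriv (\<lambda>x. a * cos (of_int n * x) + b * sin (of_int n * x)) =
        (\<lambda>x. of_int n * b * cos (of_int n * x) + (- of_int n * a) * sin (of_int n * x))"
      using DERIV_imp_deriv[OF d] by blast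
    then show ?case
      using Suc[of "of_int n * b" "- of_int n * a"] by (simp add: funpow_swap1)
  qed
  moreover have "cos (of_int n * (x + 2 * pi)) = cos (of_int n * x)"
    "sin (of_int n * (x + 2 * pi)) = sin (of_int n * x)" for x
    using sin_cos_eq_iff[of "of_int n * (x + 2 * pi)" "of_int n * x"] 
    by (auto simp: algebra_simps intro!: exI[of _ n])
  ultimately show ?thesis
    by (simp add: smooth_periodic_def)
qed

lift_definition cos_test :: "int \<Rightarrow> torus_test" is "\<lambda>n x. cos (of_int n * x)"
  using smooth_periodic_trig[of 1 _ 0] by simp

lift_definition sin_test :: "int \<Rightarrow> torus_test" is "\<lambda>n x. sin (of_int n * x)"
  using smooth_periodic_trig[of 0 _ 1] by simp

lemma cos_test_0: "cos_test 0 = const_test 1"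
  by transfer simp

lemma sin_test_0: "sin_test 0 = 0"
  by transfer simp

lemma test_deriv_cos: "test_deriv (cos_test n) = (- of_int n) *\<^sub>R sin_test n"
  by (rule test_deriv_eqI)
    (auto simp: cos_test.rep_eq sin_test.rep_eq test_fun_simps intro!: derivative_eq_intros)

lemma test_deriv_sin: "test_deriv (sin_test n) = of_int n *\<^sub>R cos_test n"
  by (rule test_deriv_eqI)
    (auto simp: cos_test.rep_eq sin_test.rep_eq test_fun_simps intro!: derivative_eq_intros)

definition trig_space :: "torus_test set" where
  "trig_space = span (range cos_test \<union> range sin_test)"

lemma cos_in_trig_space: "cos_test n \<in> trig_space"
  and sin_in_trig_space: "sin_test n \<in> trig_space"
  by (auto simp: trig_space_def intro: span_base)

lemma trig_space_add: "p \<in> trig_space \<Longrightarrow> q \<in> trig_space \<Longrightarrow> p + q \<in> trig_space"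
  and trig_space_diff: "p \<in> trig_space \<Longrightarrow> q \<in> trig_space \<Longrightarrow> p - q \<in> trig_space"
  and trig_space_scale: "p \<in> trig_space \<Longrightarrow> c *\<^sub>R p \<in> trig_space"
  and trig_space_0: "0 \<in> trig_space"
  by (simp_all add: trig_space_def span_add span_diff span_scale span_zero)

lemma const_in_trig_space: "const_test c \<in> trig_space"
  by (subst const_test_scaleR) (simp add: trig_space_scale cos_in_trig_space flip: cos_test_0)

lemma trig_space_induct [consumes 1, case_names zero add scale cos sin]:
  assumes "p \<in> trig_space" and "P 0" "\<And>p q. P p \<Longrightarrow> P q \<Longrightarrow> P (p + q)" "\<And>c p. P p \<Longrightarrow> P (c *\<^sub>R p)"
    and "\<And>n. P (cos_test n)" "\<And>n. P (sin_test n)"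
  shows "P p"
proof -
  have "subspace (Collect P)"
    using assms by (auto simp: subspace_def)
  moreover have "range cos_test \<union> range sin_test \<subseteq> Collect P"
    using assms by auto
  ultimately show ?thesis
    using assms(1) span_minimal unfolding trig_space_def by blast
qed

text \<open>Primitives of trigonometric polynomials of mean zero are again trigonometric polynomials. This lifts
  uniform approximation to approximation of all derivatives.\<close>

lemma test_primitive_in_trig_space: "p \<in> trig_space \<Longrightarrow> test_primitive p \<in> trig_space"
proof (induction rule: trig_space_induct)
  case (cos n)
  show ?case
  proof (cases "n = 0")
    case True
    then have "test_primitive (cos_test n) = 0"
      by (intro test_primitive_eqI[where c = 1])
        (simp_all add: cos_test_0 linear_0[OF linear_test_deriv] test_fun_zero)
    then show ?thesis by (simp add: trig_space_0)
  next
    case False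
    then have "test_primitive (cos_test n) = (1 / of_int n) *\<^sub>R sin_test n"
      by (intro test_primitive_eqI[where c = 0])
        (simp_all add: test_linear test_deriv_sin test_fun_simps sin_test.rep_eq
          linear_0[OF linear_const_test])
    then show ?thesis by (simp add: trig_space_scale sin_in_trig_space)
  qed
next
  case (sin n)
  show ?case
  proof (cases "n = 0")
    case True
    then show ?thesis
      by (simp add: sin_test_0 trig_space_0 linear_0[OF linear_test_primitive])
  next
    case False
    then have "test_primitive (sin_test n) = (1 / of_int n) *\<^sub>R (cos_test 0 - cos_test n)"
      by (intro test_primitive_eqI[where c = 0])
        (simp_all add: test_linear test_deriv_cos test_fun_simps cos_test.rep_eq
          linear_0[OF linear_const_test])
    then show ?thesis by (simp add: trig_space_scale trig_space_diff cos_in_trig_space)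
  qed
qed (simp_all add: linear_0[OF linear_test_primitive] test_linear trig_space_0 trig_space_add
    trig_space_scale)

text \<open>The product-to-sum formulas, applied to one factor after the other.\<close>

lemma trig_space_mult:
  assumes "p \<in> trig_space" "q \<in> trig_space"
  shows "\<exists>r\<in>trig_space. \<forall>x. test_fun r x = test_fun p x * test_fun q x"
proof -
  have *: "\<exists>r\<in>trig_space. \<forall>x. test_fun r x = test_fun p x * test_fun q x"
    if e: "\<And>n. \<exists>r\<in>trig_space. \<forall>x. test_fun r x = test_fun p x * cos (of_int n * x)"
      "\<And>n. \<exists>r\<in>trig_space. \<forall>x. test_fun r x = test_fun p x * sin (of_int n * x)"
      and "q \<in> trig_space" for p q
    using \<open>q \<in> trig_space\<close>
  proof (induction rule: trig_space_induct)
    case zero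
    then show ?case by (intro bexI[of _ 0]) (simp_all add: test_fun_zero trig_space_0)
  next
    case (add q q')
    then obtain r r' where "r \<in> trig_space" "\<forall>x. test_fun r x = test_fun p x * test_fun q x"
      "r' \<in> trig_space" "\<forall>x. test_fun r' x = test_fun p x * test_fun q' x" by blast
    then show ?case
      by (intro bexI[of _ "r + r'"]) (simp_all add: test_fun_simps trig_space_add algebra_simps)
  next
    case (scale c q)
    then obtain r where "r \<in> trig_space" "\<forall>x. test_fun r x = test_fun p x * test_fun q x" by blast
    then show ?case
      by (intro bexI[of _ "c *\<^sub>R r"]) (simp_all add: test_fun_simps trig_space_scale)
  qed (use e in \<open>simp_all add: cos_test.rep_eq sin_test.rep_eq\<close>)
  have cc: "cos (of_int m * x) * cos (of_int n * x) =
      test_fun ((1 / 2) *\<^sub>R (cos_test (m - n) + cos_test (m + n))) x"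
    and sc: "sin (of_int m * x) * cos (of_int n * x) =
      test_fun ((1 / 2) *\<^sub>R (sin_test (m + n) + sin_test (m - n))) x"
    and ss: "sin (of_int m * x) * sin (of_int n * x) =
      test_fun ((1 / 2) *\<^sub>R (cos_test (m - n) - cos_test (m + n))) x" for m n x
    by (simp_all add: test_fun_simps cos_test.rep_eq sin_test.rep_eq algebra_simps
        cos_add cos_diff sin_add sin_diff)
  have "\<exists>r\<in>trig_space. \<forall>x. test_fun r x = test_fun p x * cos (of_int m * x)"
    "\<exists>r\<in>trig_space. \<forall>x. test_fun r x = test_fun p x * sin (of_int m * x)" for m
  proof -
    have "\<exists>r\<in>trig_space. \<forall>x. test_fun r x = test_fun (cos_test m) x * test_fun p x"
      by (rule *[OF _ _ assms(1)])
        (auto simp: cos_test.rep_eq cc sc[of _ _ m] mult.commute[of _ "sin _"]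
          intro!: trig_space_add trig_space_scale cos_in_trig_space sin_in_trig_space)
    then show "\<exists>r\<in>trig_space. \<forall>x. test_fun r x = test_fun p x * cos (of_int m * x)"
      by (simp add: cos_test.rep_eq mult.commute)
    have "\<exists>r\<in>trig_space. \<forall>x. test_fun r x = test_fun (sin_test m) x * test_fun p x"
      by (rule *[OF _ _ assms(1)])
        (auto simp: sin_test.rep_eq sc ss
          intro!: trig_space_add trig_space_diff trig_space_scale cos_in_trig_space sin_in_trig_space)
    then show "\<exists>r\<in>trig_space. \<forall>x. test_fun r x = test_fun p x * sin (of_int m * x)"
      by (simp add: sin_test.rep_eq mult.commute)
  qed
  then show ?thesis
    using * assms(2) by blast
qed

lemma real_polynomial_on_circle:
  assumes "real_polynomial_function g"
  shows "\<exists>p\<in>trig_space. \<forall>t. test_fun p t = g (cis t)"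
  using assms
proof (induction rule: real_polynomial_function.induct)
  case (linear f)
  then interpret bounded_linear f .
  have "f (cis t) = test_fun (f 1 *\<^sub>R cos_test 1 + f \<i> *\<^sub>R sin_test 1) t" for t
  proof -
    have "cis t = cos t *\<^sub>R 1 + sin t *\<^sub>R \<i>"
      by (simp add: complex_eq_iff)
    then show ?thesis
      by (simp only: add scale) (simp add: test_fun_simps cos_test.rep_eq sin_test.rep_eq)
  qed
  then show ?case
    by (intro bexI[of _ "f 1 *\<^sub>R cos_test 1 + f \<i> *\<^sub>R sin_test 1"])
      (simp_all add: trig_space_add trig_space_scale cos_in_trig_space sin_in_trig_space)
next
  case (const c)
  then show ?case
    by (intro bexI[of _ "const_test c"]) (simp_all add: const_test.rep_eq const_in_trig_space)
next
  case (add f g)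
  then obtain p q where "p \<in> trig_space" "\<forall>t. test_fun p t = f (cis t)"
    "q \<in> trig_space" "\<forall>t. test_fun q t = g (cis t)" by blast
  then show ?case
    by (intro bexI[of _ "p + q"]) (simp_all add: test_fun_simps trig_space_add)
next
  case (mult f g)
  then show ?case
    using trig_space_mult by metis
qed

text \<open>Weierstrass' theorem on the unit circle in the plane: the polynomials in \<open>cos t\<close> and \<open>sin t\<close> are
  the trigonometric polynomials.\<close>

lemma trig_uniform_approximation:
  assumes "e > 0"
  shows "\<exists>p\<in>trig_space. \<forall>x. \<bar>test_fun p x - test_fun \<phi> x\<bar> \<le> e"
proof -
  define f where "f z = test_fun \<phi> (Arg z)" for z
  have f_cis: "f (cis t) = test_fun \<phi> t" for t
  proof -
    have "cis (Arg (cis t)) = cis t"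
      by (simp add: cis_Arg sgn_if sgn_div_norm)
    then obtain n :: int where "Arg (cis t) = t + 2 * pi * n"
      using sin_cos_eq_iff[of "Arg (cis t)" t] by (auto simp: complex_eq_iff)
    then show ?thesis
      using test_fun_periodic_int[of \<phi> t n] by (simp add: f_def mult_ac)
  qed
  \<comment> \<open>\<open>Arg\<close> jumps, but \<open>cis\<close> maps the compact interval \<open>[0, 2\<pi>]\<close> onto the circle and so is a
    quotient map: preimages of closed sets under \<open>f\<close> are images of compact sets under \<open>cis\<close>.\<close>
  have "continuous_on (sphere 0 1) f"
  proof (subst continuous_on_closed_vimage, simp, intro allI impI)
    fix B :: "real set" assume "closed B"
    have "f -` B \<inter> sphere 0 1 = cis ` (test_fun \<phi> -` B \<inter> {0..2*pi})"
    proof (intro equalityI subsetI)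
      fix z assume z: "z \<in> f -` B \<inter> sphere 0 1"
      then have zA: "z = cis (Arg z)"
        by (metis IntD2 cis_Arg mem_sphere_0 norm_zero sgn_div_norm inverse_1 scaleR_one zero_neq_one)
      obtain n y where y: "Arg z = y + of_int n * (2 * pi)" "0 \<le> y" "y < 2 * pi"
        by (rule torus_representative)
      have "cis (Arg z) = cis y"
        using sin_cos_eq_iff[of "Arg z" y] y(1) by (auto simp: complex_eq_iff mult_ac)
      with zA have "z = cis y" by simp
      then show "z \<in> cis ` (test_fun \<phi> -` B \<inter> {0..2*pi})"
        using z y f_cis by auto
    qed (auto simp: f_cis)
    moreover have "compact (cis ` (test_fun \<phi> -` B \<inter> {0..2*pi}))"
      using \<open>closed B\<close> 
      by (intro compact_continuous_image closed_Int_compact closed_vimage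
          continuous_on_test_fun continuous_intros) auto
    ultimately show "closed (f -` B \<inter> sphere 0 1)"
      by (simp add: compact_imp_closed)
  qed
  then obtain g where g: "real_polynomial_function g" "\<And>z. z \<in> sphere 0 1 \<Longrightarrow> \<bar>f z - g z\<bar> < e"
    using Stone_Weierstrass_real_polynomial_function[of "sphere 0 1" f e] assms by auto
  then obtain p where "p \<in> trig_space" "\<forall>t. test_fun p t = g (cis t)"
    using real_polynomial_on_circle by blast
  moreover have "\<bar>g (cis t) - test_fun \<phi> t\<bar> \<le> e" for t
    using g(2)[of "cis t"] by (simp add: f_cis abs_minus_commute)
  ultimately show ?thesis by metis
qed

text \<open>Induction on the number of derivatives: approximate \<open>\<phi>'\<close> by \<open>q\<close> and take the primitive of \<open>q\<close> with
  the value of \<open>\<phi>\<close> at \<open>0\<close>. The primitive of \<open>q\<close> omits its mean, which is small because the mean of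
  \<open>\<phi>'\<close> is zero.\<close>

lemma trig_smooth_approximation:
  assumes "e > 0"
  shows "\<exists>p\<in>trig_space. \<forall>j\<le>k. \<forall>x. \<bar>test_fun ((test_deriv ^^ j) (p - \<phi>)) x\<bar> \<le> e"
  using assms
proof (induction k arbitrary: \<phi> e)
  case 0
  then show ?case
    using trig_uniform_approximation[of e \<phi>] by (simp add: test_fun_simps)
next
  case (Suc k)
  \<comment> \<open>The factor \<open>4\<pi>\<close> is the bound of \<open>test_primitive_le\<close>.\<close>
  define d where "d = e / (4 * pi)"
  have d: "d > 0" "4 * pi * d = e" using Suc.prems by (auto simp: d_def)
  have "2 * d \<le> 4 * pi * d"
    using d(1) pi_gt3 by (intro mult_right_mono) auto
  with d have 2: "2 * d \<le> e" by simp
  obtain q where q: "q \<in> trig_space"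
    "\<forall>j\<le>k. \<forall>x. \<bar>test_fun ((test_deriv ^^ j) (q - test_deriv \<phi>)) x\<bar> \<le> d"
    using Suc.IH[OF d(1)] by blast
  define r where "r = q - test_deriv \<phi>"
  define p where "p = const_test (test_fun \<phi> 0) + test_primitive q"
  have p: "p - \<phi> = test_primitive r"
    by (simp add: p_def r_def test_linear test_primitive_deriv)
  have r: "\<bar>test_fun ((test_deriv ^^ j) r) x\<bar> \<le> d" if "j \<le> k" for j x
    using q(2) that by (simp add: r_def)
  from r[of 0] have r0: "\<bar>test_fun r x\<bar> \<le> d" for x by simp
  have "\<bar>test_fun ((test_deriv ^^ j) (p - \<phi>)) x\<bar> \<le> e" if "j \<le> Suc k" for j x
  proof (cases j)
    case 0
    then show ?thesis
      using test_primitive_le[OF r0, of x] d by (simp add: p)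
  next
    case (Suc i)
    then have eq: "(test_deriv ^^ j) (p - \<phi>) = (test_deriv ^^ i) (r - const_test (test_mean r))"
      by (simp add: p funpow_swap1 test_deriv_primitive)
    show ?thesis
    proof (cases i)
      case 0
      then show ?thesis
        unfolding eq using r0[of x] test_mean_le[OF r0] 2
        by (simp add: test_fun_simps const_test.rep_eq)
    next
      case (Suc l)
      have "(test_deriv ^^ i) (r - const_test (test_mean r)) = (test_deriv ^^ i) r"
        by (simp add: Suc funpow_swap1 test_linear test_deriv_const)
      then show ?thesis
        unfolding eq using r[of i x] that \<open>j = Suc i\<close> 2 d by simp
    qed
  qed
  moreover have "p \<in> trig_space"
    using q by (simp add: p_def trig_space_add const_in_trig_space test_primitive_in_trig_space)
  ultimately show ?case by blast
qed

lemma pairing_eq_0_if_trig: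
  assumes "\<And>n. pairing F (cos_test n) = 0" "\<And>n. pairing F (sin_test n) = 0"
  shows "pairing F \<phi> = 0"
proof -
  have "\<exists>p\<in>trig_space. \<forall>j\<le>n. \<forall>x. \<bar>test_fun ((test_deriv ^^ j) (p - \<phi>)) x\<bar> \<le> 1 / real (Suc n)" for n
    by (rule trig_smooth_approximation) simp
  then obtain p where p: "\<And>n. p n \<in> trig_space"
    "\<And>n j x. j \<le> n \<Longrightarrow> \<bar>test_fun ((test_deriv ^^ j) (p n - \<phi>)) x\<bar> \<le> 1 / real (Suc n)"
    by metis
  have "test_tendsto p \<phi>"
    unfolding test_tendsto_bounds_iff
  proof (intro allI impI)
    fix k and e :: real assume "e > 0"
    then obtain N where "N > 0" "1 / real N < e"
      using real_arch_inverse[of e] by (auto simp: inverse_eq_divide)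
    have "\<forall>n\<ge>max k N. \<forall>x. \<bar>test_fun ((test_deriv ^^ k) (p n - \<phi>)) x\<bar> \<le> e"
    proof (intro allI impI)
      fix n x assume n: "n \<ge> max k N"
      have "\<bar>test_fun ((test_deriv ^^ k) (p n - \<phi>)) x\<bar> \<le> 1 / real (Suc n)"
        using n by (intro p) auto
      also have "\<dots> \<le> 1 / real N"
        using n \<open>N > 0\<close> by (intro divide_left_mono) auto
      finally show "\<bar>test_fun ((test_deriv ^^ k) (p n - \<phi>)) x\<bar> \<le> e"
        using \<open>1 / real N < e\<close> by simp
    qed
    then show "\<forall>\<^sub>F n in sequentially. \<forall>x. \<bar>test_fun ((test_deriv ^^ k) (p n - \<phi>)) x\<bar> \<le> e"
      unfolding eventually_sequentially by blast
  qed
  then have "(\<lambda>n. pairing F (p n)) \<longlonglongrightarrow> pairing F \<phi>"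
    by (rule pairing_tendsto)
  moreover have "pairing F (p n) = 0" for n
    using p(1)[of n]
    by (induction rule: trig_space_induct)
      (simp_all add: assms test_linear linear_0[OF linear_pairing])
  ultimately show ?thesis
    by (simp add: LIMSEQ_const_iff)
qed

section \<open>Identification of \<open>exp_A\<close>\<close>

text \<open>The energy \<open>c a\<^sup>2 + b\<^sup>2\<close> is conserved. It controls only \<open>b\<close> if \<open>c = 0\<close>, the case of the mean value;
  then \<open>a\<close> vanishes because its derivative does.\<close>

lemma oscillator_unique:
  fixes a b :: "real \<Rightarrow> real"
  assumes a: "\<And>t. (a has_real_derivative b t) (at t)"
    and b: "\<And>t. (b has_real_derivative - c * a t) (at t)"
    and "c \<ge> 0" "a 0 = 0" "b 0 = 0"
  shows "a t = 0" "b t = 0"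
proof -
  have "((\<lambda>t. c * (a t)\<^sup>2 + (b t)\<^sup>2) has_real_derivative 0) (at t)" for t
    by (auto intro!: derivative_eq_intros a b)
  then have E: "c * (a t)\<^sup>2 + (b t)\<^sup>2 = 0" for t
    using DERIV_isconst_all[of "\<lambda>t. c * (a t)\<^sup>2 + (b t)\<^sup>2" t 0] assms by simp
  have b0: "b t = 0" for t
    using E[of t] \<open>c \<ge> 0\<close> by (simp add: add_nonneg_eq_0_iff)
  then show "b t = 0" by simp
  show "a t = 0"
    using DERIV_isconst_all[of a t 0] a b0 \<open>a 0 = 0\<close> by simp
qed

text \<open>Pairing with eigenfunctions of \<open>D\<^sup>2\<close> avoids differentiating a product of a curve of distributions with
  a curve of test functions, for which weak differentiability alone would not suffice without a uniform
  boundedness argument.\<close>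

lemma wave_unique:
  assumes "g 0 = f" and g: "\<And>s. has_weak_derivative g (op_A (g s)) s"
  shows "g t = wave t f"
proof -
  define F G where "F s = fst (g s) - fst (wave s f)" and "G s = snd (g s) - snd (wave s f)" for s
  have FG: "pairing (F s) \<phi> = pairing (fst (g s)) \<phi> - pairing (fst (wave s f)) \<phi>"
    "pairing (G s) \<phi> = pairing (snd (g s)) \<phi> - pairing (snd (wave s f)) \<phi>" for s \<phi>
    by (simp_all add: F_def G_def minus_torus_distribution.rep_eq)
  have F: "((\<lambda>s. pairing (F s) \<phi>) has_real_derivative pairing (G s) \<phi>) (at s)" for \<phi> s
    unfolding FG
    by (rule DERIV_diff) (use g[of s] wave_has_deriv[of f s] in \<open>simp_all add: op_A_def has_weak_derivative_def\<close>)
  have G: "((\<lambda>s. pairing (G s) \<phi>) has_real_derivative pairing (F s) (test_deriv (test_deriv \<phi>))) (at s)" for \<phi> s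
    unfolding FG
    by (rule DERIV_diff)
      (use g[of s] wave_has_deriv[of f s] in \<open>simp_all add: op_A_def pairing_deriv has_weak_derivative_def\<close>)
  have eigen: "pairing (F s) \<phi> = 0" "pairing (G s) \<phi> = 0"
    if \<phi>: "test_deriv (test_deriv \<phi>) = - c *\<^sub>R \<phi>" "c \<ge> 0" for \<phi> c s
  proof -
    have "((\<lambda>s. pairing (G s) \<phi>) has_real_derivative - c * pairing (F s) \<phi>) (at s)" for s
      using G[of \<phi> s] \<phi> by (simp add: test_linear)
    note G' = this
    have 0: "pairing (F 0) \<phi> = 0" "pairing (G 0) \<phi> = 0"
      by (simp_all add: FG wave_0 \<open>g 0 = f\<close>)
    show "pairing (F s) \<phi> = 0" "pairing (G s) \<phi> = 0"
      by (rule oscillator_unique[of "\<lambda>s. pairing (F s) \<phi>" "\<lambda>s. pairing (G s) \<phi>", OF F G' \<phi>(2) 0])+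
  qed
  have c: "test_deriv (test_deriv (cos_test n)) = - (of_int n * of_int n) *\<^sub>R cos_test n" for n
    by (simp add: test_deriv_cos test_deriv_sin test_linear)
  have s: "test_deriv (test_deriv (sin_test n)) = - (of_int n * of_int n) *\<^sub>R sin_test n" for n
    by (simp add: test_deriv_cos test_deriv_sin test_linear)
  have "pairing (F t) \<phi> = 0" "pairing (G t) \<phi> = 0" for \<phi>
    by (rule pairing_eq_0_if_trig; rule eigen, rule c s, rule zero_le_square)+
  then show ?thesis
    by (intro prod_eqI distribution_eqI) (simp_all add: FG)
qed

lemma exp_A_eq_wave:
  assumes "f \<in> state_space"
  shows "exp_A t f = wave t f"
proof -
  have "(THE g. (\<forall>s. g s \<in> state_space) \<and> g 0 = f \<and> (\<forall>s. has_weak_derivative g (op_A (g s)) s)) =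
      (\<lambda>t. wave t f)"
    by (rule the_equality)
      (auto simp: assms wave_in_state_space wave_0 wave_has_deriv intro!: ext wave_unique)
  then show ?thesis
    by (simp add: exp_A_def)
qed

section \<open>Functionals with bounded densities\<close>

definition bounded_density :: "(torus_test \<Rightarrow> real) \<Rightarrow> bool" where
  "bounded_density J \<longleftrightarrow> (\<exists>g \<in> borel_measurable (lebesgue_on {-pi..pi}).
     (\<exists>M. AE x in lebesgue_on {-pi..pi}. \<bar>g x\<bar> \<le> M) \<and>
     (\<forall>\<phi>. has_bochner_integral (lebesgue_on {-pi..pi}) (\<lambda>x. g x * test_fun \<phi> x) (J \<phi>)))"

lemma L_infinity_iff: "F \<in> L_infinity \<longleftrightarrow> bounded_density (pairing F)"
  by (simp add: L_infinity_def represents_def bounded_density_def)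

lemma bounded_density_add:
  assumes "bounded_density J" "bounded_density K"
  shows "bounded_density (\<lambda>\<phi>. J \<phi> + K \<phi>)"
proof -
  obtain g M h N where
    gh: "g \<in> borel_measurable (lebesgue_on {-pi..pi})" "h \<in> borel_measurable (lebesgue_on {-pi..pi})"
    and M: "AE x in lebesgue_on {-pi..pi}. \<bar>g x\<bar> \<le> M" "AE x in lebesgue_on {-pi..pi}. \<bar>h x\<bar> \<le> N"
    and i: "\<And>\<phi>. has_bochner_integral (lebesgue_on {-pi..pi}) (\<lambda>x. g x * test_fun \<phi> x) (J \<phi>)"
      "\<And>\<phi>. has_bochner_integral (lebesgue_on {-pi..pi}) (\<lambda>x. h x * test_fun \<phi> x) (K \<phi>)"
    using assms unfolding bounded_density_def by blast
  have "AE x in lebesgue_on {-pi..pi}. \<bar>g x + h x\<bar> \<le> M + N"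
    using M by eventually_elim linarith
  moreover have "has_bochner_integral (lebesgue_on {-pi..pi}) (\<lambda>x. (g x + h x) * test_fun \<phi> x) (J \<phi> + K \<phi>)" for \<phi>
    using has_bochner_integral_add[OF i] by (simp add: distrib_right)
  ultimately show ?thesis
    unfolding bounded_density_def using gh by (intro bexI[of _ "\<lambda>x. g x + h x"]) auto
qed

lemma bounded_density_cmult:
  assumes "bounded_density J"
  shows "bounded_density (\<lambda>\<phi>. c * J \<phi>)"
proof -
  obtain g M where
    g: "g \<in> borel_measurable (lebesgue_on {-pi..pi})"
    and M: "AE x in lebesgue_on {-pi..pi}. \<bar>g x\<bar> \<le> M"
    and i: "\<And>\<phi>. has_bochner_integral (lebesgue_on {-pi..pi}) (\<lambda>x. g x * test_fun \<phi> x) (J \<phi>)"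
    using assms unfolding bounded_density_def by blast
  have "AE x in lebesgue_on {-pi..pi}. \<bar>c * g x\<bar> \<le> \<bar>c\<bar> * M"
    using M by eventually_elim (simp add: abs_mult mult_left_mono)
  moreover have "has_bochner_integral (lebesgue_on {-pi..pi}) (\<lambda>x. (c * g x) * test_fun \<phi> x) (c * J \<phi>)" for \<phi>
    using has_bochner_integral_mult_right[OF i] by (simp add: mult.assoc)
  ultimately show ?thesis
    unfolding bounded_density_def using g by (intro bexI[of _ "\<lambda>x. c * g x"]) auto
qed

lemma bounded_density_mean: "bounded_density test_mean"
proof -
  have "has_bochner_integral (lebesgue_on {-pi..pi}) (\<lambda>x. (1 / (2 * pi)) * test_fun \<phi> x) (test_mean \<phi>)" for \<phi>
    using has_bochner_integral_mult_right[OF has_integral_test_fun[of \<phi>], of "1 / (2 * pi)"] by simp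
  then show ?thesis
    unfolding bounded_density_def by (intro bexI[of _ "\<lambda>x. 1 / (2 * pi)"]) auto
qed

lemma integrable_bounded_on_interval:
  fixes f :: "real \<Rightarrow> real"
  assumes "f \<in> borel_measurable (lebesgue_on {a..b})" and "\<And>x. x \<in> {a..b} \<Longrightarrow> \<bar>f x\<bar> \<le> M"
  shows "integrable (lebesgue_on {a..b}) f"
proof -
  interpret finite_measure "lebesgue_on {a..b}"
    by (rule finite_measureI) (subst emeasure_restrict_space; simp add: emeasure_lborel_Icc_eq)
  show ?thesis
    by (rule integrable_const_bound[where B = M]) (use assms in auto)
qed

lemma integrable_times_continuous:
  fixes u :: "real \<Rightarrow> real"
  assumes u: "u \<in> borel_measurable (lebesgue_on {a..b})" and M: "\<And>x. x \<in> {a..b} \<Longrightarrow> \<bar>u x\<bar> \<le> M"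
    and h: "continuous_on {a..b} h"
  shows "integrable (lebesgue_on {a..b}) (\<lambda>x. u x * h x)"
proof -
  have "bounded (h ` {a..b})"
    by (intro compact_imp_bounded compact_continuous_image h) auto
  then obtain N where N: "\<And>x. x \<in> {a..b} \<Longrightarrow> \<bar>h x\<bar> \<le> N"
    unfolding bounded_iff by (metis image_eqI real_norm_def)
  have "h \<in> borel_measurable (lebesgue_on {a..b})"
    by (rule continuous_imp_measurable_on_sets_lebesgue[OF h]) simp
  moreover have "\<bar>u x * h x\<bar> \<le> M * N" if "x \<in> {a..b}" for x
    unfolding abs_mult using M[OF that] N[OF that] by (intro mult_mono) auto
  ultimately show ?thesis
    using u by (intro integrable_bounded_on_interval[where M = "M * N"]) auto
qed

lemma borel_measurable_lebesgue_affine: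
  fixes v :: "real \<Rightarrow> real"
  assumes "v \<in> borel_measurable lebesgue" "c \<noteq> 0"
  shows "(\<lambda>x. v (t + c * x)) \<in> borel_measurable lebesgue"
  using measurable_compose[OF lebesgue_affine_measurable[of "\<lambda>_. c" t] assms(1)] assms(2) by simp

lemma has_bochner_integral_lebesgue_on_iff:
  fixes f :: "real \<Rightarrow> real"
  assumes "\<And>x. x \<notin> {a..b} \<Longrightarrow> f x = 0"
  shows "has_bochner_integral (lebesgue_on {a..b}) f i \<longleftrightarrow> has_bochner_integral lebesgue f i"
proof -
  have "(\<lambda>x. indicator {a..b} x *\<^sub>R f x) = f"
    by (intro ext) (metis assms indicator_simps(1) indicator_simps(2) scaleR_one scaleR_zero_left)
  then show ?thesis
    by (simp add: has_bochner_integral_restrict_space)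
qed

text \<open>The density is the sum of the translates of \<open>v\<close> by multiples of \<open>2\<pi>\<close>, cut off to one period. Only finitely
  many of them are nonzero there, because \<open>v\<close> has bounded support; hence the sum is bounded.\<close>

lemma bounded_density_fold:
  fixes v :: "real \<Rightarrow> real"
  assumes v: "v \<in> borel_measurable lebesgue" "\<And>x. \<bar>v x\<bar> \<le> M"
    and supp: "\<And>x. x \<notin> {a..b} \<Longrightarrow> v x = 0"
  shows "bounded_density (\<lambda>\<phi>. integral\<^sup>L lebesgue (\<lambda>x. v x * test_fun \<phi> x))"
proof -
  \<comment> \<open>Half-open sheets \<open>[(2k - 1)\<pi>, (2k + 1)\<pi>)\<close> partition the line, so that no null sets intervene.\<close>
  define sheet where "sheet x = \<lfloor>(x + pi) / (2 * pi)\<rfloor>" for x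
  define N where "N = {sheet a..sheet b}"
  define w where "w k x = (if sheet x = k then v x else 0)" for k x
  define g where "g x = (\<Sum>k\<in>N. w k (of_int k * (2 * pi) + 1 * x))" for x
  have sheet_eq: "sheet x = k \<longleftrightarrow> of_int k * (2 * pi) - pi \<le> x \<and> x < of_int k * (2 * pi) + pi" for x k
    unfolding sheet_def floor_eq_iff by (simp add: field_simps)
  have v_split: "v x = (\<Sum>k\<in>N. w k x)" for x
  proof (cases "x \<in> {a..b}")
    case True
    then have "sheet x \<in> N"
      by (auto simp: N_def sheet_def intro!: floor_mono divide_right_mono)
    then show ?thesis
      by (simp add: w_def N_def)
  next
    case False
    then have "v x = 0" by (rule supp)
    then show ?thesis by (simp add: w_def sum.neutral)
  qed
  have w_meas: "w k \<in> borel_measurable lebesgue" for k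
  proof -
    have "{x. sheet x = k} = {of_int k * (2 * pi) - pi ..< of_int k * (2 * pi) + pi}"
      by (auto simp: sheet_eq)
    then have "{x. sheet x = k} \<in> sets lebesgue" by simp
    then show ?thesis
      unfolding w_def using v(1) by (intro measurable_If) auto
  qed
  have w_shift: "w k (of_int k * (2 * pi) + 1 * x) = 0" if "x \<notin> {-pi..pi}" for k x
    using that by (auto simp: w_def sheet_eq)
  have "has_bochner_integral (lebesgue_on {-pi..pi}) (\<lambda>x. g x * test_fun \<phi> x)
      (integral\<^sup>L lebesgue (\<lambda>x. v x * test_fun \<phi> x))" for \<phi>
  proof -
    have w_int: "integrable lebesgue (\<lambda>x. w k x * test_fun \<phi> x)" for k
    proof -
      have "integrable (lebesgue_on {a..b}) (\<lambda>x. w k x * test_fun \<phi> x)"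
      proof (rule integrable_times_continuous[where M = M])
        show "w k \<in> borel_measurable (lebesgue_on {a..b})"
          using w_meas by (rule measurable_restrict_space1)
        show "\<bar>w k x\<bar> \<le> M" for x
          using v(2)[of x] by (auto simp: w_def)
      qed (rule continuous_on_test_fun)
      moreover have "w k x * test_fun \<phi> x = 0" if "x \<notin> {a..b}" for x
        using supp[OF that] by (simp add: w_def)
      ultimately show ?thesis
        using has_bochner_integral_lebesgue_on_iff[of a b "\<lambda>x. w k x * test_fun \<phi> x"]
        by (simp add: integrable.simps)
    qed
    let ?i = "\<lambda>k. integral\<^sup>L lebesgue (\<lambda>x. w k x * test_fun \<phi> x)"
    have sum_v: "has_bochner_integral lebesgue (\<lambda>x. \<Sum>k\<in>N. w k x * test_fun \<phi> x) (\<Sum>k\<in>N. ?i k)"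
      by (intro has_bochner_integral_sum has_bochner_integral_integrable w_int)
    have "has_bochner_integral lebesgue
        (\<lambda>x. w k (of_int k * (2 * pi) + 1 * x) * test_fun \<phi> (of_int k * (2 * pi) + 1 * x)) (?i k)" for k
      using has_bochner_integral_integrable[OF w_int[of k]]
      by (subst (asm) has_bochner_integral_lebesgue_real_affine_iff[of 1 _ _ "of_int k * (2 * pi)"]) simp_all
    moreover have "test_fun \<phi> (of_int k * (2 * pi) + 1 * x) = test_fun \<phi> x" for k x
      using test_fun_periodic_int[of \<phi> x k] by (simp add: add.commute)
    ultimately have "has_bochner_integral lebesgue
        (\<lambda>x. w k (of_int k * (2 * pi) + 1 * x) * test_fun \<phi> x) (?i k)" for k
      by simp
    then have "has_bochner_integral lebesgue (\<lambda>x. g x * test_fun \<phi> x) (\<Sum>k\<in>N. ?i k)"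
      unfolding g_def sum_distrib_right by (rule has_bochner_integral_sum)
    moreover have "(\<Sum>k\<in>N. ?i k) = integral\<^sup>L lebesgue (\<lambda>x. v x * test_fun \<phi> x)"
      using has_bochner_integral_integral_eq[OF sum_v] by (simp add: v_split sum_distrib_right)
    moreover have "g x * test_fun \<phi> x = 0" if "x \<notin> {-pi..pi}" for x
      unfolding g_def w_shift[OF that] by simp
    ultimately show ?thesis
      by (subst has_bochner_integral_lebesgue_on_iff) auto
  qed
  moreover have "g \<in> borel_measurable (lebesgue_on {-pi..pi})"
    unfolding g_def
    by (intro measurable_restrict_space1 borel_measurable_sum borel_measurable_lebesgue_affine w_meas) auto
  moreover have "\<bar>g x\<bar> \<le> real (card N) * M" for x
  proof -
    have "\<bar>w k y\<bar> \<le> M" for k y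
      using v(2)[of y] by (auto simp: w_def)
    then show ?thesis
      unfolding g_def by (intro order_trans[OF sum_abs] sum_bounded_above) auto
  qed
  ultimately show ?thesis
    unfolding bounded_density_def by (intro bexI[of _ g]) auto
qed

lemma bounded_density_control:
  assumes u: "u \<in> borel_measurable (lebesgue_on {0..T})" and M: "\<And>s. s \<in> {0..T} \<Longrightarrow> \<bar>u s\<bar> \<le> M" and "M \<ge> 0"
  shows "bounded_density (\<lambda>\<phi>. integral\<^sup>L (lebesgue_on {0..T}) (\<lambda>s. u s * test_fun \<phi> s))" (is ?A)
    and "bounded_density (\<lambda>\<phi>. integral\<^sup>L (lebesgue_on {0..T}) (\<lambda>s. u s * test_fun \<phi> (- s)))" (is ?B)
proof -
  define v where "v s = (if s \<in> {0..T} then u s else 0)" for s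
  have v: "v \<in> borel_measurable lebesgue" "\<bar>v s\<bar> \<le> M" for s
    unfolding v_def
    by (rule borel_measurable_if[THEN iffD2, OF _ u]) (use M \<open>M \<ge> 0\<close> in auto)
  have *: "integral\<^sup>L (lebesgue_on {0..T}) (\<lambda>s. u s * h s) = integral\<^sup>L lebesgue (\<lambda>s. v s * h s)" for h
    by (auto simp: integral_restrict_space v_def indicator_def intro!: Bochner_Integration.integral_cong)
  have "bounded_density (\<lambda>\<phi>. integral\<^sup>L lebesgue (\<lambda>s. v s * test_fun \<phi> s))"
    using v by (rule bounded_density_fold[of _ _ 0 T]) (auto simp: v_def)
  then show ?A by (simp add: *)
  have "integral\<^sup>L lebesgue (\<lambda>s. v s * test_fun \<phi> (- s)) = integral\<^sup>L lebesgue (\<lambda>s. v (- s) * test_fun \<phi> s)" for \<phi>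
    using lebesgue_integral_real_affine[of "-1" "\<lambda>s. v s * test_fun \<phi> (- s)" 0] by simp
  moreover have "(\<lambda>s. v (- s)) \<in> borel_measurable lebesgue"
    using borel_measurable_lebesgue_affine[OF v(1), of "-1" 0] by simp
  then have "bounded_density (\<lambda>\<phi>. integral\<^sup>L lebesgue (\<lambda>s. v (- s) * test_fun \<phi> s))"
    using v(2) by (rule bounded_density_fold[of _ _ "-T" 0]) (auto simp: v_def)
  ultimately show ?B by (simp add: *)
qed

text \<open>A control has to be bounded everywhere, whereas a density is bounded only almost everywhere: it is set
  to zero where it exceeds its essential bound.\<close>

lemma bounded_density_cutoff:
  assumes "bounded_density J"
  shows "\<exists>v M. v \<in> borel_measurable lebesgue \<and> (\<forall>x. \<bar>v x\<bar> \<le> M) \<and>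
    (\<forall>x. x \<notin> {-pi..pi} \<longrightarrow> v x = 0) \<and>
    (\<forall>\<phi>. has_bochner_integral lebesgue (\<lambda>x. v x * test_fun \<phi> x) (J \<phi>))"
proof -
  obtain g M where
    g: "g \<in> borel_measurable (lebesgue_on {-pi..pi})"
    and M: "AE x in lebesgue_on {-pi..pi}. \<bar>g x\<bar> \<le> M"
    and i: "\<And>\<phi>. has_bochner_integral (lebesgue_on {-pi..pi}) (\<lambda>x. g x * test_fun \<phi> x) (J \<phi>)"
    using assms unfolding bounded_density_def by blast
  define h where "h x = (if \<bar>g x\<bar> \<le> M then g x else 0)" for x
  define v where "v x = (if x \<in> {-pi..pi} then h x else 0)" for x
  have h: "h \<in> borel_measurable (lebesgue_on {-pi..pi})"
    using g unfolding h_def by measurable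
  show ?thesis
  proof (intro exI conjI allI impI)
    show "v \<in> borel_measurable lebesgue"
      unfolding v_def by (rule borel_measurable_if[THEN iffD2, OF _ h]) simp
    show "\<bar>v x\<bar> \<le> \<bar>M\<bar>" for x
      by (auto simp: v_def h_def)
    show "v x = 0" if "x \<notin> {-pi..pi}" for x
      using that by (auto simp: v_def)
    show "has_bochner_integral lebesgue (\<lambda>x. v x * test_fun \<phi> x) (J \<phi>)" for \<phi>
    proof -
      have \<phi>: "test_fun \<phi> \<in> borel_measurable (lebesgue_on {-pi..pi})"
        using integrable_test_fun by blast
      have "has_bochner_integral (lebesgue_on {-pi..pi}) (\<lambda>x. h x * test_fun \<phi> x) (J \<phi>)"
      proof (rule has_bochner_integral_cong_AE[THEN iffD1, OF _ _ _ i])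
        show "AE x in lebesgue_on {-pi..pi}. g x * test_fun \<phi> x = h x * test_fun \<phi> x"
          using M by eventually_elim (simp add: h_def)
      qed (use g h \<phi> in auto)
      then have "has_bochner_integral (lebesgue_on {-pi..pi}) (\<lambda>x. v x * test_fun \<phi> x) (J \<phi>)"
        by (rule has_bochner_integral_cong[THEN iffD1, OF refl _ refl, rotated]) (simp add: v_def)
      then show ?thesis
        by (subst (asm) has_bochner_integral_lebesgue_on_iff) (auto simp: v_def)
    qed
  qed
qed

text \<open>The weak integral is a distribution because the bound is in the supremum norm, uniformly in \<open>s\<close>.\<close>

lemma weak_integral_exists:
  fixes F :: "real \<Rightarrow> torus_distribution"
  assumes u: "u \<in> borel_measurable (lebesgue_on {0..t})" and K: "\<And>s. s \<in> {0..t} \<Longrightarrow> \<bar>u s\<bar> \<le> K"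
    and cont: "\<And>\<phi>. continuous_on {0..t} (\<lambda>s. pairing (F s) \<phi>)"
    and bound: "\<And>\<phi> M s. (\<And>x. \<bar>test_fun \<phi> x\<bar> \<le> M) \<Longrightarrow> s \<in> {0..t} \<Longrightarrow> \<bar>pairing (F s) \<phi>\<bar> \<le> C * M"
  obtains I where
    "\<And>\<phi>. has_bochner_integral (lebesgue_on {0..t}) (\<lambda>s. u s * pairing (F s) \<phi>) (pairing I \<phi>)"
proof -
  let ?J = "\<lambda>\<phi>. integral\<^sup>L (lebesgue_on {0..t}) (\<lambda>s. u s * pairing (F s) \<phi>)"
  have int: "integrable (lebesgue_on {0..t}) (\<lambda>s. u s * pairing (F s) \<phi>)" for \<phi>
    by (intro integrable_times_continuous[OF u K] cont)
  have "linear ?J"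
    by (rule linearI) (simp_all add: test_linear distrib_left int mult.left_commute[of "u _"])
  moreover have "\<bar>?J \<phi>\<bar> \<le> measure lebesgue {0..t} * K * C * M" if M: "\<And>x. \<bar>test_fun \<phi> x\<bar> \<le> M" for \<phi> M
  proof -
    have "\<bar>?J \<phi>\<bar> \<le> integral\<^sup>L (lebesgue_on {0..t}) (\<lambda>s. K * (C * M))"
    proof (rule integral_abs_bound_integral)
      show "integrable (lebesgue_on {0..t}) (\<lambda>s. K * (C * M))"
        by (rule integrable_bounded_on_interval[of _ _ _ "\<bar>K * (C * M)\<bar>"]) auto
      fix s assume "s \<in> space (lebesgue_on {0..t})"
      then have s: "s \<in> {0..t}" by simp
      show "\<bar>u s * pairing (F s) \<phi>\<bar> \<le> K * (C * M)"
        unfolding abs_mult using K[OF s] bound[OF M s] by (intro mult_mono) auto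
    qed (rule int)
    then show ?thesis
      by (simp add: measure_restrict_space mult_ac)
  qed
  ultimately have "pairing (Abs_torus_distribution ?J) = ?J"
    by (rule distributionI)
  then have "has_bochner_integral (lebesgue_on {0..t}) (\<lambda>s. u s * pairing (F s) \<phi>)
      (pairing (Abs_torus_distribution ?J) \<phi>)" for \<phi>
    using int by (simp add: has_bochner_integral_iff)
  then show thesis by (rule that)
qed

section \<open>The controlled string\<close>

lemma vec_B_in_state_space: "vec_B \<in> state_space"
  by (simp add: vec_B_def state_space_iff even_distribution_def pairing_0 pairing_dirac
      test_reflect.rep_eq)

lemma pairing_exp_A_vec_B:
  "pairing (fst (exp_A r vec_B)) \<phi> = test_fun (wave_sin r \<phi>) 0"
  "pairing (snd (exp_A r vec_B)) \<phi> = test_fun (wave_cos r \<phi>) 0"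
  unfolding exp_A_eq_wave[OF vec_B_in_state_space] pairing_wave
  by (simp_all add: vec_B_def pairing_0 pairing_dirac)

lemma pairing_exp_A_vec_B_explicit:
  "pairing (fst (exp_A r vec_B)) \<phi> =
     r * test_mean \<phi> + (test_fun (test_primitive \<phi>) r - test_fun (test_primitive \<phi>) (- r)) / 2"
  "pairing (snd (exp_A r vec_B)) \<phi> = (test_fun \<phi> r + test_fun \<phi> (- r)) / 2"
  by (simp_all add: pairing_exp_A_vec_B wave_sin_def wave_cos_def test_fun_simps translate.rep_eq
      const_test.rep_eq)

lemma control_integral_exists:
  assumes u: "u \<in> borel_measurable (lebesgue_on {0..T})" and K: "\<And>s. s \<in> {0..T} \<Longrightarrow> \<bar>u s\<bar> \<le> K"
    and t: "t \<in> {0..T}"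
  shows "\<exists>I. has_weak_integral (\<lambda>s. u s *\<^sub>R exp_A (t - s) vec_B) I {0..t}"
proof -
  have u': "u \<in> borel_measurable (lebesgue_on {0..t})" "\<And>s. s \<in> {0..t} \<Longrightarrow> \<bar>u s\<bar> \<le> K"
    using measurable_restrict_mono[OF u] K t by auto
  have b0: "\<bar>pairing (fst (exp_A (t - s) vec_B)) \<phi>\<bar> \<le> (t + 4 * pi) * M"
    if M: "\<And>x. \<bar>test_fun \<phi> x\<bar> \<le> M" and s: "s \<in> {0..t}" for \<phi> M s
  proof -
    have "\<bar>(t - s) * test_mean \<phi>\<bar> \<le> t * M"
      unfolding abs_mult using s t test_mean_le[OF M] by (intro mult_mono) auto
    moreover have "\<bar>(test_fun (test_primitive \<phi>) (t - s) - test_fun (test_primitive \<phi>) (- (t - s))) / 2\<bar>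
        \<le> 4 * pi * M"
    proof -
      have "\<bar>(a - b) / 2\<bar> \<le> c" if "\<bar>a\<bar> \<le> c" "\<bar>b\<bar> \<le> c" for a b c :: real
        using that unfolding abs_le_iff by (simp add: field_simps)
      then show ?thesis by (simp only: test_primitive_le[OF M])
    qed
    ultimately show ?thesis
      unfolding pairing_exp_A_vec_B_explicit distrib_right by linarith
  qed
  have b1: "\<bar>pairing (snd (exp_A (t - s) vec_B)) \<phi>\<bar> \<le> 1 * M"
    if M: "\<And>x. \<bar>test_fun \<phi> x\<bar> \<le> M" and s: "s \<in> {0..t}" for \<phi> M s
  proof -
    have "\<bar>(a + b) / 2\<bar> \<le> 1 * c" if "\<bar>a\<bar> \<le> c" "\<bar>b\<bar> \<le> c" for a b c :: real
      using that unfolding abs_le_iff by (simp add: field_simps)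
    then show ?thesis by (simp only: pairing_exp_A_vec_B_explicit M)
  qed
  have c: "continuous_on {0..t} (\<lambda>s. pairing (fst (exp_A (t - s) vec_B)) \<phi>)"
    "continuous_on {0..t} (\<lambda>s. pairing (snd (exp_A (t - s) vec_B)) \<phi>)" for \<phi>
    unfolding pairing_exp_A_vec_B_explicit by (intro continuous_intros; simp)+
  obtain I0 where I0: "\<And>\<phi>. has_bochner_integral (lebesgue_on {0..t})
      (\<lambda>s. u s * pairing (fst (exp_A (t - s) vec_B)) \<phi>) (pairing I0 \<phi>)"
    by (rule weak_integral_exists[OF u' c(1) b0]) auto
  obtain I1 where I1: "\<And>\<phi>. has_bochner_integral (lebesgue_on {0..t})
      (\<lambda>s. u s * pairing (snd (exp_A (t - s) vec_B)) \<phi>) (pairing I1 \<phi>)"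
    by (rule weak_integral_exists[OF u' c(2) b1]) auto
  have "has_weak_integral (\<lambda>s. u s *\<^sub>R exp_A (t - s) vec_B) (I0, I1) {0..t}"
    using I0 I1 by (simp add: has_weak_integral_def pairing_scaleR)
  then show ?thesis by blast
qed

lemma test_mean_translate: "test_mean (translate t \<phi>) = test_mean \<phi>"
proof -
  have "test_deriv (translate t (test_primitive \<phi>) - test_primitive \<phi>) = translate t \<phi> - \<phi>"
    by (simp add: test_linear test_deriv_translate test_deriv_primitive translate_const)
  then show ?thesis
    using test_mean_deriv[of "translate t (test_primitive \<phi>) - test_primitive \<phi>"]
    by (simp add: test_linear)
qed

lemma represents_const_iff: "represents (\<lambda>_. c) F \<longleftrightarrow> (\<forall>\<phi>. pairing F \<phi> = 2 * pi * c * test_mean \<phi>)"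
proof -
  have "has_bochner_integral (lebesgue_on {-pi..pi}) (\<lambda>x. c * test_fun \<phi> x) (2 * pi * c * test_mean \<phi>)" for \<phi>
    using has_bochner_integral_mult_right[OF has_integral_test_fun[of \<phi>], of c] by (simp add: mult_ac)
  then show ?thesis
    unfolding represents_def by (metis has_bochner_integral_eq)
qed

text \<open>The damped state is transported back to time \<open>0\<close>: the two components of the terminal condition are
  tested with \<open>C\<^sub>T \<psi>\<close> and \<open>S\<^sub>T D\<^sup>2 \<psi>\<close>, or with \<open>C\<^sub>T D \<psi>\<close> and \<open>S\<^sub>T D \<psi>\<close>, chosen so that in the
  difference one component of the initial state drops out and the other one appears undisturbed. The
  integrands simplify by the addition theorems of \<open>cosh\<close> and \<open>sinh\<close>.\<close>

lemma densities_if_damped: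
  fixes f0 f1 :: torus_distribution
  assumes f: "(f0, f1) \<in> state_space" and "T \<ge> 0"
    and u: "u \<in> borel_measurable (lebesgue_on {0..T})" "bounded (u ` {0..T})"
    and g: "string_solution T u (f0, f1) g" "g T \<in> constant_states"
  shows "dist_deriv f0 \<in> L_infinity \<and> f1 \<in> L_infinity"
proof -
  obtain K where K: "\<And>s. s \<in> {0..T} \<Longrightarrow> \<bar>u s\<bar> \<le> K"
    using u(2) unfolding bounded_iff by (metis image_eqI real_norm_def)
  have "K \<ge> 0" using K[of 0] \<open>T \<ge> 0\<close> by auto
  obtain I where I: "has_weak_integral (\<lambda>s. u s *\<^sub>R exp_A (T - s) vec_B) I {0..T}"
    and gT: "g T = exp_A T (f0, f1) + I"
    using g(1) \<open>T \<ge> 0\<close> unfolding string_solution_def by (metis atLeastAtMost_iff order_refl)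
  obtain c0 c1 where c: "\<And>\<phi>. pairing (fst (g T)) \<phi> = 2 * pi * c0 * test_mean \<phi>"
    "\<And>\<phi>. pairing (snd (g T)) \<phi> = 2 * pi * c1 * test_mean \<phi>"
    using g(2) by (cases "g T") (auto simp: constant_states_def represents_const_iff)
  have final0: "pairing f0 (wave_cos T \<phi>) + pairing f1 (wave_sin T \<phi>) + pairing (fst I) \<phi> = 2 * pi * c0 * test_mean \<phi>"
    and final1: "pairing f0 (wave_sin T (test_deriv (test_deriv \<phi>))) + pairing f1 (wave_cos T \<phi>) + pairing (snd I) \<phi>
      = 2 * pi * c1 * test_mean \<phi>" for \<phi>
    using c[of \<phi>] by (simp_all add: gT exp_A_eq_wave[OF f] pairing_plus pairing_wave)
  have I0: "has_bochner_integral (lebesgue_on {0..T}) (\<lambda>s. u s * test_fun (wave_sin (T - s) \<phi>) 0) (pairing (fst I) \<phi>)"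
    and I1: "has_bochner_integral (lebesgue_on {0..T}) (\<lambda>s. u s * test_fun (wave_cos (T - s) \<phi>) 0) (pairing (snd I) \<phi>)" for \<phi>
    using I by (simp_all add: has_weak_integral_def pairing_scaleR pairing_exp_A_vec_B)
  define J where "J \<phi> = integral\<^sup>L (lebesgue_on {0..T}) (\<lambda>s. u s * test_fun \<phi> s)" for \<phi>
  define J' where "J' \<phi> = integral\<^sup>L (lebesgue_on {0..T}) (\<lambda>s. u s * test_fun \<phi> (- s))" for \<phi>
  have J: "bounded_density J" and J': "bounded_density J'"
    unfolding J_def J'_def by (rule bounded_density_control[OF u(1) K \<open>K \<ge> 0\<close>]; assumption)+
  have Ji: "has_bochner_integral (lebesgue_on {0..T}) (\<lambda>s. u s * test_fun \<phi> s) (J \<phi>)" for \<phi>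
    unfolding J_def
    by (intro has_bochner_integral_integrable integrable_times_continuous[OF u(1) K] continuous_on_test_fun)
  have J'i: "has_bochner_integral (lebesgue_on {0..T}) (\<lambda>s. u s * test_fun \<phi> (- s)) (J' \<phi>)" for \<phi>
    unfolding J'_def
    by (intro has_bochner_integral_integrable integrable_times_continuous[OF u(1) K] continuous_intros)
  have f1_eq: "pairing f1 \<psi> = 2 * pi * c1 * test_mean \<psi> + (- 1 / 2) * (J \<psi> + J' \<psi>)" for \<psi>
  proof -
    \<comment> \<open>\<open>\<xi> = S\<^sub>T D \<psi>\<close>, so that \<open>D \<xi> = S\<^sub>T D\<^sup>2 \<psi>\<close>.\<close>
    define \<xi> where "\<xi> = (1 / 2) *\<^sub>R (translate T \<psi> - translate (- T) \<psi>)"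
    have sin_\<xi>: "wave_sin r (test_deriv \<xi>) = (1 / 2) *\<^sub>R (translate r \<xi> - translate (- r) \<xi>)" for r
      by (rule wave_sin_deriv)
    have "wave_cos T (test_deriv \<xi>) = wave_sin T (test_deriv (test_deriv (wave_cos T \<psi>)))"
      unfolding wave_sin_deriv
      by (rule test_fun_eqI)
        (simp add: \<xi>_def wave_cos_def test_linear test_deriv_translate test_fun_simps translate.rep_eq algebra_simps)
    moreover have "wave_cos T (wave_cos T \<psi>) - wave_sin T (test_deriv \<xi>) = \<psi>"
      unfolding sin_\<xi>
      by (rule test_fun_eqI)
        (simp add: \<xi>_def wave_cos_def test_linear test_fun_simps translate.rep_eq algebra_simps)
    then have "pairing f1 \<psi> = pairing f1 (wave_cos T (wave_cos T \<psi>)) - pairing f1 (wave_sin T (test_deriv \<xi>))"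
      by (simp flip: test_linear)
    moreover have "test_mean (wave_cos T \<psi>) = test_mean \<psi>"
      by (simp add: wave_cos_def test_linear test_mean_translate)
    ultimately have "pairing f1 \<psi> = 2 * pi * c1 * test_mean \<psi>
        - (pairing (snd I) (wave_cos T \<psi>) - pairing (fst I) (test_deriv \<xi>))"
      using final0[of "test_deriv \<xi>"] final1[of "wave_cos T \<psi>"] by (simp add: test_mean_deriv)
    moreover have "pairing (snd I) (wave_cos T \<psi>) - pairing (fst I) (test_deriv \<xi>) = 1 / 2 * (J \<psi> + J' \<psi>)"
    proof (rule has_bochner_integral_eq[OF has_bochner_integral_diff[OF I1 I0]])
      have "u s * test_fun (wave_cos (T - s) (wave_cos T \<psi>)) 0 - u s * test_fun (wave_sin (T - s) (test_deriv \<xi>)) 0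
          = 1 / 2 * (u s * test_fun \<psi> s + u s * test_fun \<psi> (- s))" for s
        unfolding sin_\<xi>
        by (simp add: \<xi>_def wave_cos_def test_linear test_fun_simps translate.rep_eq algebra_simps)
      moreover have "has_bochner_integral (lebesgue_on {0..T})
          (\<lambda>s. 1 / 2 * (u s * test_fun \<psi> s + u s * test_fun \<psi> (- s))) (1 / 2 * (J \<psi> + J' \<psi>))"
        by (intro has_bochner_integral_mult_right has_bochner_integral_add Ji J'i)
      ultimately show "has_bochner_integral (lebesgue_on {0..T})
          (\<lambda>s. u s * test_fun (wave_cos (T - s) (wave_cos T \<psi>)) 0 -
               u s * test_fun (wave_sin (T - s) (test_deriv \<xi>)) 0) (1 / 2 * (J \<psi> + J' \<psi>))"
        by (simp only:)
    qed
    ultimately show ?thesis by simp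
  qed
  have f0_eq: "pairing (dist_deriv f0) \<psi> = 1 / 2 * (J' \<psi> + (- 1) * J \<psi>)" for \<psi>
  proof -
    \<comment> \<open>\<open>\<eta> = S\<^sub>T D \<psi>\<close>.\<close>
    define \<eta> where "\<eta> = (1 / 2) *\<^sub>R (translate T \<psi> - translate (- T) \<psi>)"
    have cos_deriv: "wave_cos T (test_deriv \<psi>) = test_deriv (wave_cos T \<psi>)"
      by (simp add: wave_cos_def test_linear test_deriv_translate)
    have "wave_cos T (wave_cos T (test_deriv \<psi>)) - wave_sin T (test_deriv (test_deriv \<eta>)) = test_deriv \<psi>"
      unfolding wave_sin_deriv
      by (rule test_fun_eqI)
        (simp add: \<eta>_def wave_cos_def test_linear test_deriv_translate test_fun_simps translate.rep_eq algebra_simps)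
    then have "pairing f0 (test_deriv \<psi>) = pairing f0 (wave_cos T (wave_cos T (test_deriv \<psi>))) -
        pairing f0 (wave_sin T (test_deriv (test_deriv \<eta>)))"
      by (simp flip: test_linear)
    moreover have "wave_sin T (wave_cos T (test_deriv \<psi>)) = wave_cos T \<eta>"
      unfolding cos_deriv wave_sin_deriv
      by (rule test_fun_eqI)
        (simp add: \<eta>_def wave_cos_def test_linear test_fun_simps translate.rep_eq algebra_simps)
    moreover have "test_mean \<eta> = 0"
      by (simp add: \<eta>_def test_linear test_mean_translate)
    ultimately have "pairing f0 (test_deriv \<psi>) = pairing (snd I) \<eta> - pairing (fst I) (wave_cos T (test_deriv \<psi>))"
      using final0[of "wave_cos T (test_deriv \<psi>)"] final1[of \<eta>]
      by (simp add: cos_deriv test_mean_deriv)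
    moreover have "pairing (snd I) \<eta> - pairing (fst I) (wave_cos T (test_deriv \<psi>)) = 1 / 2 * (J \<psi> + (- 1) * J' \<psi>)"
    proof (rule has_bochner_integral_eq[OF has_bochner_integral_diff[OF I1 I0]])
      have "u s * test_fun (wave_cos (T - s) \<eta>) 0 - u s * test_fun (wave_sin (T - s) (wave_cos T (test_deriv \<psi>))) 0
          = 1 / 2 * (u s * test_fun \<psi> s + (- 1) * (u s * test_fun \<psi> (- s)))" for s
        unfolding cos_deriv wave_sin_deriv
        by (simp add: \<eta>_def wave_cos_def test_linear test_fun_simps translate.rep_eq algebra_simps)
      moreover have "has_bochner_integral (lebesgue_on {0..T})
          (\<lambda>s. 1 / 2 * (u s * test_fun \<psi> s + (- 1) * (u s * test_fun \<psi> (- s)))) (1 / 2 * (J \<psi> + (- 1) * J' \<psi>))"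
        by (intro has_bochner_integral_mult_right has_bochner_integral_add Ji J'i)
      ultimately show "has_bochner_integral (lebesgue_on {0..T})
          (\<lambda>s. u s * test_fun (wave_cos (T - s) \<eta>) 0 -
               u s * test_fun (wave_sin (T - s) (wave_cos T (test_deriv \<psi>))) 0) (1 / 2 * (J \<psi> + (- 1) * J' \<psi>))"
        by (simp only:)
    qed
    ultimately show ?thesis by (simp add: pairing_deriv)
  qed
  have "bounded_density (\<lambda>\<psi>. 2 * pi * c1 * test_mean \<psi> + (- 1 / 2) * (J \<psi> + J' \<psi>))"
    by (intro bounded_density_add bounded_density_cmult bounded_density_mean J J')
  moreover have "bounded_density (\<lambda>\<psi>. 1 / 2 * (J' \<psi> + (- 1) * J \<psi>))"
    by (intro bounded_density_add bounded_density_cmult J J')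
  ultimately show ?thesis
    unfolding L_infinity_iff f1_eq[symmetric] f0_eq[symmetric] by blast
qed

text \<open>The control \<open>- (a + b)\<close> lives on one period \<open>[-\<pi>, \<pi>]\<close> of the circle. Shifted by \<open>2\<pi>\<close> it becomes a
  control on \<open>[\<pi>, 3\<pi>] \<subseteq> [0, 4\<pi>]\<close>, and at time \<open>4\<pi>\<close> the translations are the identity.\<close>

lemma damped_if_densities:
  fixes f0 f1 :: torus_distribution
  assumes f: "(f0, f1) \<in> state_space"
    and L: "dist_deriv f0 \<in> L_infinity" "f1 \<in> L_infinity"
  shows "\<exists>T\<ge>0. \<exists>u :: real \<Rightarrow> real.
            u \<in> borel_measurable (lebesgue_on {0..T}) \<and> bounded (u ` {0..T}) \<and>
            (\<exists>g. string_solution T u (f0, f1) g \<and> g T \<in> constant_states)"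
proof -
  define T where "T = 4 * pi"
  define J where "J \<phi> = - 1 * (pairing f1 \<phi> + pairing (dist_deriv f0) \<phi>)" for \<phi>
  have "bounded_density J"
    unfolding J_def using L by (intro bounded_density_cmult bounded_density_add) (simp_all add: L_infinity_iff)
  then obtain v and K :: real where v: "v \<in> borel_measurable lebesgue" "\<And>x. \<bar>v x\<bar> \<le> K"
    "\<And>x. x \<notin> {-pi..pi} \<Longrightarrow> v x = 0"
    "\<And>\<phi>. has_bochner_integral lebesgue (\<lambda>x. v x * test_fun \<phi> x) (J \<phi>)"
    using bounded_density_cutoff by metis
  define u where "u s = v (- 2 * pi + 1 * s)" for s
  have u: "u \<in> borel_measurable (lebesgue_on {0..T})"
    unfolding u_def by (intro measurable_restrict_space1 borel_measurable_lebesgue_affine v) simp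
  have K: "\<bar>u s\<bar> \<le> K" for s
    by (simp add: u_def v)
  have u_int: "has_bochner_integral (lebesgue_on {0..T}) (\<lambda>s. u s * test_fun \<phi> s) (J \<phi>)" for \<phi>
  proof -
    have "test_fun \<phi> (- 2 * pi + 1 * s) = test_fun \<phi> s" for s
      using test_fun_periodic_int[of \<phi> s "-1"] by simp
    then have "has_bochner_integral lebesgue (\<lambda>s. u s * test_fun \<phi> s) (J \<phi>)"
      using v(4)[of \<phi>] 
      by (subst (asm) has_bochner_integral_lebesgue_real_affine_iff[of 1 _ _ "- 2 * pi"]) (simp_all add: u_def)
    moreover have "u s = 0" if "s \<notin> {0..T}" for s
      unfolding u_def by (rule v(3)) (use that pi_gt_zero in \<open>auto simp: T_def\<close>)
    ultimately show ?thesis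
      by (subst has_bochner_integral_lebesgue_on_iff) auto
  qed
  have "\<forall>t\<in>{0..T}. \<exists>I. has_weak_integral (\<lambda>s. u s *\<^sub>R exp_A (t - s) vec_B) I {0..t}"
    using control_integral_exists[OF u] K by blast
  then obtain I where I: "\<And>t. t \<in> {0..T} \<Longrightarrow> has_weak_integral (\<lambda>s. u s *\<^sub>R exp_A (t - s) vec_B) (I t) {0..t}"
    by metis
  define g where "g t = exp_A t (f0, f1) + I t" for t
  have sol: "string_solution T u (f0, f1) g"
    using I unfolding string_solution_def g_def by blast
  have "T \<ge> 0" by (simp add: T_def)
  have IT: "has_bochner_integral (lebesgue_on {0..T}) (\<lambda>s. u s * pairing (fst (exp_A (T - s) vec_B)) \<phi>) (pairing (fst (I T)) \<phi>)"
    "has_bochner_integral (lebesgue_on {0..T}) (\<lambda>s. u s * pairing (snd (exp_A (T - s) vec_B)) \<phi>) (pairing (snd (I T)) \<phi>)" for \<phi>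
    using I[of T] \<open>T \<ge> 0\<close> by (simp_all add: has_weak_integral_def pairing_scaleR)
  have per: "translate T \<phi> = \<phi>" "translate (- T) \<phi> = \<phi>" for \<phi>
    using translate_period[of 2 \<phi>] translate_period[of "-2" \<phi>] by (simp_all add: T_def)
  have perf: "test_fun \<phi> (T - s) = test_fun \<phi> (- s)" "test_fun \<phi> (- (T - s)) = test_fun \<phi> s" for \<phi> s
    using test_fun_periodic_int[of \<phi> "- s" 2] test_fun_periodic_int[of \<phi> s "-2"]
    by (simp_all add: T_def algebra_simps)
  have even1: "pairing f1 (test_reflect \<phi>) = pairing f1 \<phi>" for \<phi>
    using f by (simp add: state_space_iff even_distribution_def)
  have odd0: "pairing (dist_deriv f0) (test_reflect \<phi>) = - pairing (dist_deriv f0) \<phi>" for \<phi>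
    using f by (simp add: state_space_iff even_distribution_def pairing_deriv test_deriv_reflect test_linear)
  have u_int': "has_bochner_integral (lebesgue_on {0..T}) (\<lambda>s. u s * test_fun \<phi> (- s)) (J (test_reflect \<phi>))" for \<phi>
    using u_int[of "test_reflect \<phi>"] by (simp add: test_reflect.rep_eq)
  have J_plus: "J (test_reflect \<phi>) + J \<phi> = - 2 * pairing f1 \<phi>"
    and J_minus: "J (test_reflect \<phi>) - J \<phi> = 2 * pairing (dist_deriv f0) \<phi>" for \<phi>
    by (simp_all add: J_def even1 odd0)
  have snd_I: "pairing (snd (I T)) \<phi> = - pairing f1 \<phi>" for \<phi>
  proof (rule has_bochner_integral_eq[OF IT(2)])
    have "has_bochner_integral (lebesgue_on {0..T})
        (\<lambda>s. 1 / 2 * (u s * test_fun \<phi> (- s) + u s * test_fun \<phi> s)) (1 / 2 * (J (test_reflect \<phi>) + J \<phi>))"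
      by (intro has_bochner_integral_mult_right has_bochner_integral_add u_int u_int')
    moreover have "u s * pairing (snd (exp_A (T - s) vec_B)) \<phi> =
        1 / 2 * (u s * test_fun \<phi> (- s) + u s * test_fun \<phi> s)" for s
      unfolding pairing_exp_A_vec_B_explicit perf by (simp add: algebra_simps)
    ultimately show "has_bochner_integral (lebesgue_on {0..T})
        (\<lambda>s. u s * pairing (snd (exp_A (T - s) vec_B)) \<phi>) (- pairing f1 \<phi>)"
      by (simp only: J_plus) simp
  qed
  define m where "m = integral\<^sup>L (lebesgue_on {0..T}) (\<lambda>s. u s * (T - s))"
  have m: "has_bochner_integral (lebesgue_on {0..T}) (\<lambda>s. u s * (T - s)) m"
    unfolding m_def
    by (intro has_bochner_integral_integrable integrable_times_continuous[OF u K] continuous_intros)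
  have fst_I: "pairing (fst (I T)) \<phi> = test_mean \<phi> * m + pairing (dist_deriv f0) (test_primitive \<phi>)" for \<phi>
  proof (rule has_bochner_integral_eq[OF IT(1)])
    let ?P = "test_primitive \<phi>"
    have "has_bochner_integral (lebesgue_on {0..T})
        (\<lambda>s. test_mean \<phi> * (u s * (T - s)) + 1 / 2 * (u s * test_fun ?P (- s) - u s * test_fun ?P s))
        (test_mean \<phi> * m + 1 / 2 * (J (test_reflect ?P) - J ?P))"
      by (intro has_bochner_integral_mult_right has_bochner_integral_add has_bochner_integral_diff
          u_int u_int' m)
    moreover have "u s * pairing (fst (exp_A (T - s) vec_B)) \<phi> =
        test_mean \<phi> * (u s * (T - s)) + 1 / 2 * (u s * test_fun ?P (- s) - u s * test_fun ?P s)" for s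
      unfolding pairing_exp_A_vec_B_explicit perf by (simp add: field_simps)
    ultimately show "has_bochner_integral (lebesgue_on {0..T})
        (\<lambda>s. u s * pairing (fst (exp_A (T - s) vec_B)) \<phi>)
        (test_mean \<phi> * m + pairing (dist_deriv f0) ?P)"
      by (simp only: J_minus) simp
  qed
  \<comment> \<open>The terminal displacement: \<open>f\<^sub>0\<close> itself cancels against \<open>f\<^sub>0'(P \<phi>) = - f\<^sub>0(\<phi> - mean \<phi>)\<close>, and what
    remains is a multiple of the mean.\<close>
  define c where "c = m + pairing f0 (const_test 1) + T * pairing f1 (const_test 1)"
  have "pairing (fst (g T)) \<phi> = 2 * pi * (c / (2 * pi)) * test_mean \<phi>" for \<phi>
  proof -
    have "pairing f0 (const_test (test_mean \<phi>)) = test_mean \<phi> * pairing f0 (const_test 1)"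
      by (subst const_test_scaleR) (simp add: test_linear)
    then have "pairing (fst (g T)) \<phi> = c * test_mean \<phi>"
      by (simp add: g_def exp_A_eq_wave[OF f] pairing_plus pairing_wave wave_cos_def wave_sin_def per
          fst_I pairing_deriv test_deriv_primitive test_linear c_def algebra_simps)
    then show ?thesis by simp
  qed
  moreover have "pairing (snd (g T)) \<phi> = 2 * pi * 0 * test_mean \<phi>" for \<phi>
    by (simp add: g_def exp_A_eq_wave[OF f] pairing_plus pairing_wave wave_sin_deriv wave_cos_def per
        snd_I test_linear linear_0[OF linear_pairing])
  ultimately have "represents (\<lambda>_. c / (2 * pi)) (fst (g T))" "represents (\<lambda>_. 0) (snd (g T))"
    unfolding represents_const_iff by blast+
  then have "g T \<in> constant_states"
    by (cases "g T") (auto simp: constant_states_def)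
  moreover have "bounded (u ` {0..T})"
    using K by (auto simp: bounded_iff)
  ultimately show ?thesis
    using u sol \<open>T \<ge> 0\<close> by blast
qed

theorem mainTheorem2:
  fixes f0 f1 :: torus_distribution
  assumes "(f0, f1) \<in> state_space"
  shows "(\<exists>T\<ge>0. \<exists>u :: real \<Rightarrow> real.
            u \<in> borel_measurable (lebesgue_on {0..T}) \<and> bounded (u ` {0..T}) \<and>
            (\<exists>g. string_solution T u (f0, f1) g \<and> g T \<in> constant_states))
         \<longleftrightarrow> dist_deriv f0 \<in> L_infinity \<and> f1 \<in> L_infinity"
  using densities_if_damped[OF assms] damped_if_densities[OF assms] by blast

end
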